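(* Let $\alpha\ge-\frac12$. 1) For $\lambda\in\mathbb{C}$, $\Lambda_{\alpha,q}\psi_\lambda^{\alpha,q}=i\lambda\,\psi_\lambda^{\alpha,q}$. 2) For $\lambda,x\in\mathbb{R}$ and $a\in\mathbb{C}$: $\psi_\lambda^{\alpha,q}(x)=\psi_x^{\alpha,q}(\lambda)$, $\psi_{a\lambda}^{\alpha,q}(x)=\psi_\lambda^{\alpha,q}(ax)$ and $\overline{\psi_\lambda^{\alpha,q}(x)}=\psi_{-\lambda}^{\alpha,q}(x)$. 3) If $\alpha=-\frac12$, then $\psi_\lambda^{\alpha,q}(x)=e(i\lambda x;q^2)$. If $\alpha>-\frac12$, then $\psi_\lambda^{\alpha,q}$ has the $q$-integral representation of Mehler type $$\psi_\lambda^{\alpha,q}(x)=\frac12C(\alpha;q^2)\int_{-1}^1W_\alpha(t;q^2)(1+t)\,e(i\lambda xt;q^2)\,d_qt.$$ 4) For all $n\in\mathbb{N}$, $$|\partial_q^n\psi_\lambda^{\alpha,q}(x)|\le\frac{4|\lambda|^n}{(q;q)_\infty}\qquad\text{for all }\lambda,x\in\mathbb{R}_q.$$ In particular, for all $\lambda\in\mathbb{R}_q$, $\psi_\lambda^{\alpha,q}$ is bounded on $\mathbb{R}_q$ and $|\psi_\lambda^{\alpha,q}(x)|\le\frac{4}{(q;q)_\infty}$ for all $x\in\mathbb{R}_q$. 5) For all $\lambda\in\mathbb{R}_q$, $\psi_\lambda^{\alpha,q}\in\mathcal{S}_q(\mathbb{R}_q)$.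
   Context: Standing assumptions: $q\in(0,1)$ and $\frac{\log(1-q)}{\log q}\in 2\mathbb{Z}$. Functions are complex-valued. $\mathbb{R}_q=\{\pm q^n: n\in\mathbb{Z}\}$; $f_e,f_o$ are the even and odd parts of $f$. Notation: $(a;q)_\infty=\prod_{k\ge0}(1-aq^k)$, $[x]_q=\frac{1-q^x}{1-q}$, $[n]_q!=\prod_{k=1}^n[k]_q$, $\Gamma_{q^2}(x)=\frac{(q^2;q^2)_\infty}{(q^{2x};q^2)_\infty}(1-q^2)^{1-x}$. $\int_{-1}^1h(t)d_qt=(1-q)\sum_{n\ge0}q^n[h(q^n)+h(-q^n)]$. For $z\neq0$, $\partial_q f(z)=\frac{f(q^{-1}z)+f(-q^{-1}z)-f(qz)+f(-qz)-2f(-z)}{2(1-q)z}$; $\partial_q^n$ is its $n$-th iterate (acting in the variable $x$ in part 4). $\mathcal{S}_q(\mathbb{R}_q)$ is the space of functions $f$ on $\mathbb{R}_q$ such that $\sup_{x\in\mathbb{R}_q}|x^m\partial_q^nf(x)|<\infty$ for all $n,m\in\mathbb{N}$ and $\lim_{x\to0,\,x\in\mathbb{R}_q}\partial_q^nf(x)$ exists for all $n\in\mathbb{N}$ ($0\in\mathbb{N}$). $q$-Dunkl operator: $\Lambda_{\alpha,q}(f)(x)=\partial_q[H_{\alpha,q}(f)](x)+[2\alpha+1]_q\frac{f(x)-f(-x)}{2x}$, where $H_{\alpha,q}(f)=f_e+q^{2\alpha+1}f_o$. $j_\alpha(x;q^2)=\sum_{n\ge0}(-1)^n\frac{\Gamma_{q^2}(\alpha+1)q^{n(n+1)}}{\Gamma_{q^2}(\alpha+n+1)\Gamma_{q^2}(n+1)}\left(\frac{x}{1+q}\right)^{2n}$;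 $q$-Dunkl kernel: $\psi_\lambda^{\alpha,q}(x)=j_\alpha(\lambda x;q^2)+\frac{i\lambda x}{[2\alpha+2]_q}j_{\alpha+1}(\lambda x;q^2)$, defined for $\lambda,x\in\mathbb{C}$. $\cos(x;q^2)=\sum_{n\ge0}(-1)^nq^{n(n+1)}\frac{x^{2n}}{[2n]_q!}$, $\sin(x;q^2)=\sum_{n\ge0}(-1)^nq^{n(n+1)}\frac{x^{2n+1}}{[2n+1]_q!}$, $e(z;q^2)=\cos(-iz;q^2)+i\sin(-iz;q^2)$. $C(\alpha;q^2)=(1+q)\frac{\Gamma_{q^2}(\alpha+1)}{\Gamma_{q^2}(\frac12)\Gamma_{q^2}(\alpha+\frac12)}$, $W_\alpha(t;q^2)=\frac{(t^2q^2;q^2)_\infty}{(t^2q^{2\alpha+1};q^2)_\infty}$. *)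

theory Defs
  imports "HOL-Analysis.Analysis"
begin

definition q_poch_inf :: "real \<Rightarrow> real \<Rightarrow> real" where
  "q_poch_inf a q = (\<Prod>k. 1 - a * q ^ k)"

definition q_num :: "real \<Rightarrow> real \<Rightarrow> real" where
  "q_num q x = (1 - q powr x) / (1 - q)"

definition q_fact :: "real \<Rightarrow> nat \<Rightarrow> real" where
  "q_fact q n = (\<Prod>k = 1..n. q_num q (real k))"

text \<open>The \<open>q\<close>-Gamma function with base \<open>p\<close>; below it is only used with \<open>p = q\<^sup>2\<close>,
  where \<open>p powr x\<close> is \<open>q powr (2 * x)\<close>.\<close>

definition q_Gamma :: "real \<Rightarrow> real \<Rightarrow> real" where
  "q_Gamma p x = q_poch_inf p p / q_poch_inf (p powr x) p * (1 - p) powr (1 - x)"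

definition q_integral :: "real \<Rightarrow> (real \<Rightarrow> complex) \<Rightarrow> complex" where
  "q_integral q h = of_real (1 - q) * (\<Sum>n. of_real (q ^ n) * (h (q ^ n) + h (- (q ^ n))))"

text \<open>The set \<open>\<real>\<^sub>q\<close> is embedded into the complex numbers, so that the kernel, defined on all of
  the complex plane, can be used as a function on it.\<close>

definition Rq :: "real \<Rightarrow> complex set" where
  "Rq q = {x. \<exists>n::int. x = of_real (q powi n) \<or> x = - of_real (q powi n)}"

text \<open>Only meaningful for \<open>z \<noteq> 0\<close>. The values at nonzero points (at points of \<open>Rq q\<close>) of the
  iterates of this operator depend only on the values of \<open>f\<close> at nonzero points
  (at points of \<open>Rq q\<close>).\<close>

definition q_deriv :: "real \<Rightarrow> (complex \<Rightarrow> complex) \<Rightarrow> complex \<Rightarrow> complex" where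
  "q_deriv q f z =
     (f (inverse (of_real q) * z) + f (- (inverse (of_real q) * z))
        - f (of_real q * z) + f (- (of_real q * z)) - 2 * f (- z))
     / (2 * (1 - of_real q) * z)"

text \<open>Membership depends only on the restriction of \<open>f\<close> to \<open>Rq q\<close>.\<close>

definition Sq :: "real \<Rightarrow> (complex \<Rightarrow> complex) set" where
  "Sq q = {f.
     (\<forall>n m::nat. bdd_above ((\<lambda>x. cmod (x ^ m * (q_deriv q ^^ n) f x)) ` Rq q)) \<and>
     (\<forall>n::nat. \<exists>L. ((q_deriv q ^^ n) f \<longlongrightarrow> L) (at 0 within Rq q))}"

definition even_part :: "(complex \<Rightarrow> complex) \<Rightarrow> complex \<Rightarrow> complex" where
  "even_part f x = (f x + f (- x)) / 2"

definition odd_part :: "(complex \<Rightarrow> complex) \<Rightarrow> complex \<Rightarrow> complex" where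
  "odd_part f x = (f x - f (- x)) / 2"

definition H_op :: "real \<Rightarrow> real \<Rightarrow> (complex \<Rightarrow> complex) \<Rightarrow> complex \<Rightarrow> complex" where
  "H_op \<alpha> q f x = even_part f x + of_real (q powr (2 * \<alpha> + 1)) * odd_part f x"

definition q_Dunkl_op :: "real \<Rightarrow> real \<Rightarrow> (complex \<Rightarrow> complex) \<Rightarrow> complex \<Rightarrow> complex" where
  "q_Dunkl_op \<alpha> q f x =
     q_deriv q (H_op \<alpha> q f) x
     + of_real (q_num q (2 * \<alpha> + 1)) * ((f x - f (- x)) / (2 * x))"

definition q_j :: "real \<Rightarrow> real \<Rightarrow> complex \<Rightarrow> complex" where
  "q_j \<alpha> q x =
     (\<Sum>n. (-1) ^ n
        * of_real (q_Gamma (q\<^sup>2) (\<alpha> + 1) * q ^ (n * (n + 1))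
                   / (q_Gamma (q\<^sup>2) (\<alpha> + real n + 1) * q_Gamma (q\<^sup>2) (real n + 1)))
        * (x / (1 + of_real q)) ^ (2 * n))"

definition q_Dunkl_kernel :: "real \<Rightarrow> real \<Rightarrow> complex \<Rightarrow> complex \<Rightarrow> complex" where
  "q_Dunkl_kernel \<alpha> q l x =
     q_j \<alpha> q (l * x)
     + \<i> * l * x / of_real (q_num q (2 * \<alpha> + 2)) * q_j (\<alpha> + 1) q (l * x)"

definition q_cos :: "real \<Rightarrow> complex \<Rightarrow> complex" where
  "q_cos q x =
     (\<Sum>n. (-1) ^ n * of_real (q ^ (n * (n + 1))) * x ^ (2 * n) / of_real (q_fact q (2 * n)))"

definition q_sin :: "real \<Rightarrow> complex \<Rightarrow> complex" where
  "q_sin q x =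
     (\<Sum>n. (-1) ^ n * of_real (q ^ (n * (n + 1))) * x ^ (2 * n + 1) / of_real (q_fact q (2 * n + 1)))"

definition q_e :: "real \<Rightarrow> complex \<Rightarrow> complex" where
  "q_e q z = q_cos q (- \<i> * z) + \<i> * q_sin q (- \<i> * z)"

definition Mehler_C :: "real \<Rightarrow> real \<Rightarrow> real" where
  "Mehler_C \<alpha> q =
     (1 + q) * (q_Gamma (q\<^sup>2) (\<alpha> + 1) / (q_Gamma (q\<^sup>2) (1 / 2) * q_Gamma (q\<^sup>2) (\<alpha> + 1 / 2)))"

definition Mehler_W :: "real \<Rightarrow> real \<Rightarrow> real \<Rightarrow> real" where
  "Mehler_W \<alpha> q t =
     q_poch_inf (t\<^sup>2 * q\<^sup>2) (q\<^sup>2) / q_poch_inf (t\<^sup>2 * q powr (2 * \<alpha> + 1)) (q\<^sup>2)"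

end

theory Submission
  imports Defs
begin

text \<open>
  With \<open>p = q\<^sup>2\<close>, \<open>\<beta> = q powr (2 * \<alpha> + 2)\<close> and \<open>u = (1 - q) \<lambda> x\<close> the kernel is
  \<open>\<Sum>n. (-1)^n q^(n(n+1)) (u^(2n) / ((\<beta>;p)\<^sub>n (p;p)\<^sub>n) + \<i> u^(2n+1) / ((\<beta>;p)\<^sub>n\<^sub>+\<^sub>1 (p;p)\<^sub>n))\<close>,
  and comparing coefficients gives the eigenvalue equation; \<open>\<beta> = q\<close> is the \<open>q\<close>-exponential.
  By the \<open>q\<close>-binomial theorem the weights of the Mehler integral have moments \<open>(q;p)\<^sub>n / (\<beta>;p)\<^sub>n\<close>, so the
  kernel is a convex combination of \<open>q\<close>-exponentials, and every bound on \<open>q\<close>-exponentials over \<open>\<real>\<^sub>q\<close>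
  carries over to the kernel and, since \<open>q\<close>-exponentials are eigenfunctions of \<open>\<partial>\<^sub>q\<close>, to its derivatives.
  For \<open>x, \<lambda> \<in> \<real>\<^sub>q\<close> the assumption on \<open>log (1 - q) / log q\<close> makes \<open>u\<close> an integer power of \<open>q\<close> up to sign.
  The even and odd parts are multiples of \<open>(w;p)\<^sub>\<infinity> \<^sub>1\<phi>\<^sub>1(0;w;p;z)\<close> with \<open>z = p u\<^sup>2\<close>, which is symmetric in \<open>w\<close>
  and \<open>z\<close>; after exchanging them, all terms of small index vanish, which gives both the uniform bound and
  the rapid decrease.
\<close>

section \<open>Infinite \<open>q\<close>-shifted factorials and the \<open>q\<close>-binomial theorem\<close>

lemma suminf_eq_infsum:
  fixes f :: "nat \<Rightarrow> 'a :: banach"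
  assumes "summable (\<lambda>n. norm (f n))"
  shows "(\<Sum>n. f n) = infsum f UNIV"
  using norm_summable_imp_has_sum[OF assms summable_sums[OF summable_norm_cancel[OF assms]]]
  by (simp add: infsumI)

text \<open>Domination by a product of two summable sequences makes the family absolutely summable
  over pairs, so Fubini for \<open>infsum\<close> applies; absolute summability of the inner and
  outer sums brings the result back to \<open>suminf\<close>.\<close>

lemma
  fixes f :: "nat \<Rightarrow> nat \<Rightarrow> 'a :: banach"
  assumes a: "summable a" and b: "summable b"
    and nonneg: "\<And>i. 0 \<le> a i" "\<And>j. 0 \<le> b j"
    and le: "\<And>i j. norm (f i j) \<le> a i * b j"
  shows suminf_swap_dominated: "(\<Sum>i. \<Sum>j. f i j) = (\<Sum>j. \<Sum>i. f i j)"
    and summable_suminf_dominated: "summable (\<lambda>i. \<Sum>j. f i j)"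
proof -
  have sj: "summable (\<lambda>j. norm (f i j))" for i
    by (rule summable_comparison_test[of _ "\<lambda>j. a i * b j"]) (use le b in \<open>auto intro: summable_mult\<close>)
  have si: "summable (\<lambda>i. norm (f i j))" for j
    by (rule summable_comparison_test[of _ "\<lambda>i. a i * b j"]) (use le a in \<open>auto intro: summable_mult2\<close>)
  have ni: "summable (\<lambda>i. norm (\<Sum>j. f i j))"
  proof (rule summable_comparison_test[of _ "\<lambda>i. a i * suminf b"])
    have "norm (\<Sum>j. f i j) \<le> a i * suminf b" for i
      using summable_norm[OF sj[of i]] suminf_le[OF le sj[of i] summable_mult[OF b]]
        suminf_mult[OF b, of "a i"] by simp
    then show "\<exists>N. \<forall>n\<ge>N. norm (norm (\<Sum>j. f n j)) \<le> a n * suminf b" by auto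
  qed (use a in \<open>auto intro: summable_mult2\<close>)
  then show "summable (\<lambda>i. \<Sum>j. f i j)" by (rule summable_norm_cancel)
  have nj: "summable (\<lambda>j. norm (\<Sum>i. f i j))"
  proof (rule summable_comparison_test[of _ "\<lambda>j. suminf a * b j"])
    have "norm (\<Sum>i. f i j) \<le> suminf a * b j" for j
      using summable_norm[OF si[of j]] suminf_le[OF le si[of j] summable_mult2[OF a]]
        suminf_mult2[OF a, of "b j"] by simp
    then show "\<exists>N. \<forall>n\<ge>N. norm (norm (\<Sum>i. f i n)) \<le> suminf a * b n" by auto
  qed (use b in \<open>auto intro: summable_mult\<close>)
  have "a summable_on UNIV" "b summable_on UNIV"
    using a b nonneg by (simp_all add: summable_on_UNIV_nonneg_real_iff)
  then have "(\<lambda>(i, j). a i * b j) summable_on UNIV \<times> UNIV"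
    using nonneg
    by (intro summable_on_SigmaI[where g = "\<lambda>i. a i * infsum b UNIV"])
       (auto intro!: has_sum_cmult_right has_sum_infsum summable_on_cmult_left)
  then have "(\<lambda>x. norm (case x of (i, j) \<Rightarrow> f i j)) summable_on UNIV \<times> UNIV"
    by (rule summable_on_comparison_test) (use le in auto)
  then have "(\<lambda>(i, j). f i j) summable_on UNIV \<times> UNIV"
    by (rule abs_summable_summable)
  from infsum_swap_banach[OF this]
  show "(\<Sum>i. \<Sum>j. f i j) = (\<Sum>j. \<Sum>i. f i j)"
    using sj si ni nj by (simp add: suminf_eq_infsum)
qed

section \<open>Finite and infinite q-shifted factorials\<close>

definition q_poch :: "real \<Rightarrow> real \<Rightarrow> nat \<Rightarrow> real" where
  "q_poch a p n = (\<Prod>k<n. 1 - a * p ^ k)"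

text \<open>For \<open>b = 1\<close> this is (a;p)_n / (p;p)_n, for \<open>a = 1\<close>,
  \<open>b = 0\<close> it is Euler's coefficient (-1)^n p^(n(n-1)/2) / (p;p)_n. Keeping both
  parameters lets one functional equation serve both expansions.\<close>

definition q_binom_coeff :: "real \<Rightarrow> real \<Rightarrow> real \<Rightarrow> nat \<Rightarrow> real" where
  "q_binom_coeff a b p n = (\<Prod>k<n. (b - a * p ^ k) / (1 - p ^ Suc k))"

text \<open>This is \<open>(w;p)\<^sub>\<infinity> \<^sub>1\<phi>\<^sub>1(0;w;p;z)\<close>, the factor \<open>(w;p)\<^sub>\<infinity>\<close> being distributed over the terms so that
  no division by \<open>(w;p)\<^sub>n\<close> occurs.\<close>

definition phi11 :: "real \<Rightarrow> real \<Rightarrow> real \<Rightarrow> real" where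
  "phi11 p w z = (\<Sum>n. q_binom_coeff 1 0 p n * z ^ n * q_poch_inf (w * p ^ n) p)"

lemma q_poch_0 [simp]: "q_poch a p 0 = 1"
  and q_poch_Suc: "q_poch a p (Suc n) = q_poch a p n * (1 - a * p ^ n)"
  by (simp_all add: q_poch_def)

lemma q_poch_Suc_shift: "q_poch a p (Suc n) = (1 - a) * q_poch (a * p) p n"
  unfolding q_poch_def prod.lessThan_Suc_shift by (simp add: mult.assoc)

lemma q_poch_add: "q_poch a p (m + n) = q_poch a p m * q_poch (a * p ^ m) p n"
  by (induction n) (simp_all add: q_poch_Suc power_add mult_ac)

lemma q_binom_coeff_0 [simp]: "q_binom_coeff a b p 0 = 1"
  and q_binom_coeff_Suc:
    "q_binom_coeff a b p (Suc n) = q_binom_coeff a b p n * ((b - a * p ^ n) / (1 - p ^ Suc n))"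
  by (simp_all add: q_binom_coeff_def)

context
  fixes p :: real
  assumes p: "0 < p" "p < 1"
begin

lemma power_base_bounds: "0 < p ^ n" "p ^ n \<le> 1" "p ^ Suc n < 1"
  using p power_le_one[of p n] power_Suc_less_one[of p n] by auto

lemma convergent_prod_q_poch: "convergent_prod (\<lambda>k. 1 - a * p ^ k)"
  using p by (intro abs_convergent_prod_imp_convergent_prod summable_imp_abs_convergent_prod)
    (auto simp: abs_mult power_abs intro!: summable_mult summable_geometric)

lemma q_poch_LIMSEQ: "q_poch a p \<longlonglongrightarrow> q_poch_inf a p"
proof -
  have "(\<lambda>n. q_poch a p (Suc n)) \<longlonglongrightarrow> q_poch_inf a p"
    using convergent_prod_LIMSEQ[OF convergent_prod_q_poch[of a]]
    by (simp add: q_poch_def q_poch_inf_def lessThan_Suc_atMost)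
  then show ?thesis by (rule LIMSEQ_imp_Suc)
qed

lemma q_poch_inf_split: "q_poch_inf a p = q_poch a p n * q_poch_inf (a * p ^ n) p"
proof -
  have "(\<lambda>m. q_poch a p (n + m)) \<longlonglongrightarrow> q_poch a p n * q_poch_inf (a * p ^ n) p"
    by (auto simp: q_poch_add intro: tendsto_intros q_poch_LIMSEQ)
  moreover have "(\<lambda>m. q_poch a p (n + m)) \<longlonglongrightarrow> q_poch_inf a p"
    using LIMSEQ_ignore_initial_segment[OF q_poch_LIMSEQ[of a], of n] by (simp add: add.commute)
  ultimately show ?thesis by (rule LIMSEQ_unique[symmetric])
qed

lemma q_poch_bounds:
  assumes "0 \<le> a" "a \<le> 1"
  shows "0 \<le> q_poch a p n" "q_poch a p n \<le> 1"
proof -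
  have "0 \<le> a * p ^ k" "a * p ^ k \<le> 1" for k
    using assms power_base_bounds[of k] mult_le_one[of a "p ^ k"] by auto
  then show "0 \<le> q_poch a p n" "q_poch a p n \<le> 1"
    unfolding q_poch_def by (auto intro!: prod_nonneg prod_le_1)
qed

lemma q_poch_inf_bounds:
  assumes "0 \<le> a" "a \<le> 1"
  shows "0 \<le> q_poch_inf a p" "q_poch_inf a p \<le> 1"
  using LIMSEQ_le_const[OF q_poch_LIMSEQ[of a]] LIMSEQ_le_const2[OF q_poch_LIMSEQ[of a]]
    q_poch_bounds[OF assms] by blast+

lemma q_poch_pos:
  assumes "a < 1"
  shows "0 < q_poch a p n"
proof -
  have "a * p ^ k < 1" for k
  proof (cases "0 \<le> a")
    case True
    then have "a * p ^ k \<le> a"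
      using power_base_bounds[of k] mult_left_le by blast
    then show ?thesis using assms by linarith
  next
    case False
    then have "a * p ^ k < 0" using power_base_bounds[of k] by (simp add: mult_neg_pos)
    then show ?thesis by linarith
  qed
  then show ?thesis unfolding q_poch_def by (simp add: prod_pos)
qed

lemma q_poch_inf_pos:
  assumes "0 \<le> a" "a < 1"
  shows "0 < q_poch_inf a p"
proof -
  have "1 - a * p ^ k \<noteq> 0" for k
    using q_poch_pos[OF assms(2), of "Suc k"] by (auto simp: q_poch_Suc)
  then have "q_poch_inf a p \<noteq> 0"
    unfolding q_poch_inf_def by (intro prodinf_nonzero convergent_prod_q_poch)
  then show ?thesis using q_poch_inf_bounds[of a] assms by linarith
qed

lemma q_poch_inf_le_q_poch:
  assumes "0 \<le> a" "a \<le> 1"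
  shows "q_poch_inf a p \<le> q_poch a p n"
proof -
  have "a * p ^ n \<le> 1" using assms power_base_bounds[of n] mult_le_one[of a "p ^ n"] by auto
  then have "q_poch_inf (a * p ^ n) p \<le> 1"
    using assms power_base_bounds[of n] by (intro q_poch_inf_bounds) auto
  then show ?thesis
    using q_poch_inf_split[of a n] q_poch_bounds(1)[OF assms, of n] by (simp add: mult_left_le)
qed

text \<open>The factor of index \<open>- j\<close> is 1 - p^0 = 0. This vanishing removes the terms
  of small index in the later bounds.\<close>

lemma q_poch_inf_powi_nonpos:
  assumes "j \<le> 0"
  shows "q_poch_inf (p powi j) p = 0"
proof -
  have "p powi j * p ^ nat (- j) = 1"
    using p assms power_int_add[of p j "- j"] by (simp add: power_int_def[of p "- j"])
  then have "q_poch (p powi j) p (Suc (nat (- j))) = 0" by (simp add: q_poch_Suc)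
  then show ?thesis
    using q_poch_inf_split[of "p powi j" "Suc (nat (- j))"] by simp
qed

text \<open>For \<open>j > 0\<close> every factor lies between 0 and 1, and otherwise the product
  vanishes; the bounds are thus uniform over all integers.\<close>

lemma q_poch_inf_powi_bounds: "0 \<le> q_poch_inf (p powi j) p" "q_poch_inf (p powi j) p \<le> 1"
proof -
  have "0 \<le> q_poch_inf (p powi j) p \<and> q_poch_inf (p powi j) p \<le> 1"
  proof (cases "j \<le> 0")
    case False
    then have "p powi j = p ^ nat j" by (simp add: power_int_def)
    then show ?thesis using power_base_bounds[of "nat j"] q_poch_inf_bounds by simp
  qed (simp add: q_poch_inf_powi_nonpos)
  then show "0 \<le> q_poch_inf (p powi j) p" "q_poch_inf (p powi j) p \<le> 1" by auto
qed

section \<open>The q-binomial theorem and Euler's expansion\<close>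

lemma q_binom_coeff_eq: "q_binom_coeff a 1 p n = q_poch a p n / q_poch p p n"
  by (induction n) (auto simp: q_binom_coeff_Suc q_poch_Suc)

lemma summable_q_binom:
  assumes "\<bar>b * z\<bar> < 1"
  shows "summable (\<lambda>n. q_binom_coeff a b p n * z ^ n)"
proof -
  have "(\<lambda>n. (b - a * p ^ n) / (1 - p * p ^ n) * z) \<longlonglongrightarrow> (b - a * 0) / (1 - p * 0) * z"
    using p by (intro tendsto_intros LIMSEQ_power_zero) auto
  then have "(\<lambda>n. \<bar>(b - a * p ^ n) / (1 - p * p ^ n) * z\<bar>) \<longlonglongrightarrow> \<bar>b * z\<bar>"
    by (auto dest: tendsto_rabs)
  moreover obtain c where c: "\<bar>b * z\<bar> < c" "c < 1" using assms dense by blast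
  ultimately have "\<forall>\<^sub>F n in sequentially. \<bar>(b - a * p ^ n) / (1 - p * p ^ n) * z\<bar> < c"
    by (intro order_tendstoD)
  then obtain N where N: "\<And>n. n \<ge> N \<Longrightarrow> \<bar>(b - a * p ^ n) / (1 - p * p ^ n) * z\<bar> < c"
    by (auto simp: eventually_sequentially)
  show ?thesis
  proof (rule summable_ratio_test[of c N])
    fix n assume "n \<ge> N"
    from N[OF this] have "\<bar>q_binom_coeff a b p n * z ^ n\<bar> * \<bar>(b - a * p ^ n) / (1 - p * p ^ n) * z\<bar>
        \<le> \<bar>q_binom_coeff a b p n * z ^ n\<bar> * c"
      by (intro mult_left_mono) auto
    then show "norm (q_binom_coeff a b p (Suc n) * z ^ Suc n) \<le> c * norm (q_binom_coeff a b p n * z ^ n)"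
      by (simp add: q_binom_coeff_Suc abs_mult mult_ac)
  qed (use c in auto)
qed

text \<open>Comparing coefficients of powers of \<open>z\<close>, this is the recursion c(n+1) (1 -
  p^(n+1)) = c(n) (b - a p^n).\<close>

lemma q_binom_functional_eq:
  assumes "\<bar>b * z\<bar> < 1"
  shows "(1 - b * z) * (\<Sum>n. q_binom_coeff a b p n * z ^ n)
       = (1 - a * z) * (\<Sum>n. q_binom_coeff a b p n * (z * p) ^ n)"
proof -
  let ?c = "q_binom_coeff a b p"
  have "\<bar>b * z\<bar> * p < 1" using assms p mult_strict_mono[of "\<bar>b * z\<bar>" 1 p 1] by auto
  then have "\<bar>b * (z * p)\<bar> < 1" using p by (simp add: abs_mult mult_ac)
  note s = summable_q_binom[OF assms, of a] summable_q_binom[OF this, of a]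
  have step: "?c (Suc n) * z ^ Suc n - ?c (Suc n) * (z * p) ^ Suc n
      = b * z * (?c n * z ^ n) - a * z * (?c n * (z * p) ^ n)" for n
  proof -
    have "?c (Suc n) * (1 - p ^ Suc n) = ?c n * (b - a * p ^ n)"
      using power_base_bounds(3)[of n] by (simp add: q_binom_coeff_Suc)
    then have "z ^ Suc n * (?c (Suc n) * (1 - p ^ Suc n)) = z ^ Suc n * (?c n * (b - a * p ^ n))"
      by simp
    then show ?thesis by (simp add: algebra_simps power_mult_distrib)
  qed
  have "(\<Sum>n. ?c n * z ^ n) - (\<Sum>n. ?c n * (z * p) ^ n)
      = (\<Sum>n. ?c (Suc n) * z ^ Suc n) - (\<Sum>n. ?c (Suc n) * (z * p) ^ Suc n)"
    using suminf_split_head[OF s(1)] suminf_split_head[OF s(2)] by simp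
  also have "\<dots> = (\<Sum>n. ?c (Suc n) * z ^ Suc n - ?c (Suc n) * (z * p) ^ Suc n)"
    using s[THEN summable_ignore_initial_segment, of 1] by (intro suminf_diff) simp_all
  also have "\<dots> = (\<Sum>n. b * z * (?c n * z ^ n) - a * z * (?c n * (z * p) ^ n))"
    by (simp only: step)
  also have "\<dots> = b * z * (\<Sum>n. ?c n * z ^ n) - a * z * (\<Sum>n. ?c n * (z * p) ^ n)"
    using s by (subst suminf_diff[symmetric]) (auto simp: suminf_mult intro: summable_mult)
  finally show ?thesis by (simp add: algebra_simps)
qed

text \<open>For \<open>b = 1\<close> this is the \<open>q\<close>-binomial theorem; for \<open>a = 1\<close>, \<open>b = 0\<close> it is Euler's expansion
  of \<open>(z;p)\<^sub>\<infinity>\<close>.\<close>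

lemma q_binom_series:
  assumes "\<bar>b * z\<bar> < 1"
  shows "q_poch_inf (b * z) p * (\<Sum>n. q_binom_coeff a b p n * z ^ n) = q_poch_inf (a * z) p"
proof -
  define f where "f y = (\<Sum>n. q_binom_coeff a b p n * y ^ n)" for y
  have f0: "f 0 = 1" unfolding f_def using powser_zero[of "q_binom_coeff a b p"] by simp
  \<comment> \<open>Iterating the functional equation pushes the argument to
    \<open>z * p ^ n\<close>, which tends to 0, where \<open>f\<close> is continuous with value
    1.\<close>
  have it: "q_poch (b * z) p n * f z = q_poch (a * z) p n * f (z * p ^ n)" for n
  proof (induction n)
    case (Suc n)
    have "\<bar>b * z\<bar> * p ^ n < 1"
      using assms power_base_bounds[of n] mult_left_le[of "p ^ n" "\<bar>b * z\<bar>"] by linarith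
    then have "\<bar>b * (z * p ^ n)\<bar> < 1" using p by (simp add: abs_mult mult_ac)
    from q_binom_functional_eq[OF this, of a]
    have eq: "(1 - b * z * p ^ n) * f (z * p ^ n) = (1 - a * z * p ^ n) * f (z * p ^ Suc n)"
      by (simp add: f_def mult_ac)
    have "q_poch (b * z) p (Suc n) * f z = (1 - b * z * p ^ n) * (q_poch (b * z) p n * f z)"
      by (simp add: q_poch_Suc mult_ac)
    also have "\<dots> = q_poch (a * z) p n * ((1 - b * z * p ^ n) * f (z * p ^ n))"
      unfolding Suc.IH by (rule mult.left_commute)
    also have "\<dots> = q_poch (a * z) p n * ((1 - a * z * p ^ n) * f (z * p ^ Suc n))"
      by (simp only: eq)
    also have "\<dots> = q_poch (a * z) p (Suc n) * f (z * p ^ Suc n)"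
      by (simp add: q_poch_Suc)
    finally show ?case .
  qed simp
  have "isCont f 0"
  proof (cases "b = 0")
    case True
    then show ?thesis unfolding f_def
      using summable_q_binom[of b _ a] by (intro isCont_powser_converges_everywhere) auto
  next
    case False
    then show ?thesis unfolding f_def
      \<comment> \<open>The point 1/(2b) lies strictly inside the disc of convergence, which gives
        continuity at 0.\<close>
      using summable_q_binom[of b "1 / (2 * b)" a] by (intro isCont_powser[of _ "1 / (2 * b)"]) auto
  qed
  moreover have "(\<lambda>n. z * p ^ n) \<longlonglongrightarrow> 0"
    using p by (intro tendsto_mult_right_zero LIMSEQ_power_zero) auto
  ultimately have "(\<lambda>n. f (z * p ^ n)) \<longlonglongrightarrow> 1"
    using isCont_tendsto_compose f0 by fastforce
  then have lim: "(\<lambda>n. q_poch (a * z) p n * f (z * p ^ n)) \<longlonglongrightarrow> q_poch_inf (a * z) p * 1"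
    by (intro tendsto_mult q_poch_LIMSEQ)
  have "(\<lambda>n. q_poch (b * z) p n * f z) \<longlonglongrightarrow> q_poch_inf (b * z) p * f z"
    by (intro tendsto_mult q_poch_LIMSEQ tendsto_const)
  then have "q_poch_inf (b * z) p * f z = q_poch_inf (a * z) p * 1"
    unfolding it using lim by (rule LIMSEQ_unique)
  then show ?thesis by (simp add: f_def)
qed

lemma q_poch_inf_0 [simp]: "q_poch_inf 0 p = 1"
  by (simp add: q_poch_inf_def)

lemma summable_Euler: "summable (\<lambda>n. q_binom_coeff 1 0 p n * z ^ n)"
  and Euler_series: "(\<Sum>n. q_binom_coeff 1 0 p n * z ^ n) = q_poch_inf z p"
  using summable_q_binom[of 0 z 1] q_binom_series[of 0 z 1] by simp_all

text \<open>Each factor of the product defining the coefficient is negative, so the signs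
  alternate.\<close>

lemma abs_Euler_coeff: "\<bar>q_binom_coeff 1 0 p n\<bar> = (- 1) ^ n * q_binom_coeff 1 0 p n"
proof -
  have "0 \<le> (- 1) ^ n * q_binom_coeff 1 0 p n"
  proof (induction n)
    case (Suc n)
    have "(- 1) ^ Suc n * q_binom_coeff 1 0 p (Suc n)
        = ((- 1) ^ n * q_binom_coeff 1 0 p n) * (p ^ n / (1 - p ^ Suc n))"
      by (simp add: q_binom_coeff_Suc)
    moreover have "0 \<le> p ^ n / (1 - p ^ Suc n)"
      using power_base_bounds(1)[of n] power_base_bounds(3)[of n] by (intro divide_nonneg_nonneg) auto
    ultimately show ?case using Suc by (simp only: mult_nonneg_nonneg)
  qed simp
  moreover have "\<bar>q_binom_coeff 1 0 p n\<bar> = \<bar>(- 1) ^ n * q_binom_coeff 1 0 p n\<bar>"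
    by (simp add: abs_mult)
  ultimately show ?thesis by simp
qed

text \<open>Since the signs alternate, passing to absolute values amounts to replacing
  \<open>z\<close> by \<open>- z\<close>; hence the products with negative parameter in the later
  estimates.\<close>

lemma summable_abs_Euler: "summable (\<lambda>n. \<bar>q_binom_coeff 1 0 p n\<bar> * z ^ n)"
  and abs_Euler_series: "(\<Sum>n. \<bar>q_binom_coeff 1 0 p n\<bar> * z ^ n) = q_poch_inf (- z) p"
  using summable_Euler[of "- z"] Euler_series[of "- z"]
  by (simp_all add: abs_Euler_coeff power_minus[of z] mult_ac)

text \<open>Expanding the infinite product by Euler's series gives a double series with terms e_n
  e_m z^n w^m p^(n m), which is unchanged when (n,z) and (m,w) are exchanged.\<close>

lemma phi11_commute: "phi11 p w z = phi11 p z w"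
proof -
  let ?e = "q_binom_coeff 1 0 p"
  have double: "phi11 p w z = (\<Sum>n. \<Sum>m. ?e n * z ^ n * (?e m * (w * p ^ n) ^ m))" for w z
    unfolding phi11_def
    by (intro suminf_cong) (simp add: suminf_mult summable_Euler flip: Euler_series)
  \<comment> \<open>The coupling factor p^(n m) is at most 1; dropping it leaves a product of two
    summable sequences.\<close>
  have le: "norm (?e n * z ^ n * (?e m * (w * p ^ n) ^ m)) \<le> (\<bar>?e n\<bar> * \<bar>z\<bar> ^ n) * (\<bar>?e m\<bar> * \<bar>w\<bar> ^ m)" for n m
  proof -
    have "(\<bar>?e n\<bar> * \<bar>z\<bar> ^ n) * (\<bar>?e m\<bar> * \<bar>w\<bar> ^ m) * (p ^ n) ^ m \<le> (\<bar>?e n\<bar> * \<bar>z\<bar> ^ n) * (\<bar>?e m\<bar> * \<bar>w\<bar> ^ m)"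
      using power_base_bounds[of "n * m"] by (intro mult_left_le) (auto simp: power_mult)
    then show ?thesis using p by (simp add: abs_mult power_abs power_mult_distrib mult_ac)
  qed
  have "phi11 p w z = (\<Sum>m. \<Sum>n. ?e n * z ^ n * (?e m * (w * p ^ n) ^ m))"
    unfolding double
    by (rule suminf_swap_dominated[OF summable_abs_Euler[of "\<bar>z\<bar>"] summable_abs_Euler[of "\<bar>w\<bar>"] _ _ le]) auto
  also have "\<dots> = phi11 p z w"
    unfolding double by (simp add: power_mult_distrib mult_ac power_mult[symmetric])
  finally show ?thesis .
qed

end

section \<open>The \<open>q\<close>-Dunkl kernel in normalised variables\<close>

text \<open>The factors before the quotient sign amount to \<open>(-1)^n q^(n(n+1)) / (q\<^sup>2;q\<^sup>2)\<^sub>n\<close>;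
  the argument \<open>u\<close> stands for \<open>(1 - q) \<lambda> x\<close>.\<close>

definition dk_even :: "real \<Rightarrow> real \<Rightarrow> complex \<Rightarrow> complex" where
  "dk_even q \<beta> u =
     (\<Sum>n. of_real (q_binom_coeff 1 0 (q\<^sup>2) n * (q\<^sup>2) ^ n / q_poch \<beta> (q\<^sup>2) n) * u ^ (2 * n))"

definition dk_odd :: "real \<Rightarrow> real \<Rightarrow> complex \<Rightarrow> complex" where
  "dk_odd q \<beta> u =
     (\<Sum>n. of_real (q_binom_coeff 1 0 (q\<^sup>2) n * (q\<^sup>2) ^ n / q_poch \<beta> (q\<^sup>2) (Suc n)) * u ^ (2 * n + 1))"

definition dk :: "real \<Rightarrow> real \<Rightarrow> complex \<Rightarrow> complex" where
  "dk q \<beta> u = dk_even q \<beta> u + \<i> * dk_odd q \<beta> u"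

lemma dk_even_minus: "dk_even q \<beta> (- u) = dk_even q \<beta> u"
  by (simp add: dk_even_def)

lemma minus_Rq: "x \<in> Rq q \<Longrightarrow> - x \<in> Rq q"
  by (auto simp: Rq_def)

context
  fixes q :: real
  assumes q: "0 < q" "q < 1"
begin

lemma q_square_bounds: "0 < q\<^sup>2" "q\<^sup>2 < 1"
  using q by (auto simp: power_less_one_iff)

text \<open>With p = q^2 the factor p^(n(n-1)/2) of Euler's coefficient and the extra p^n combine to
  q^(n(n+1)).\<close>

lemma Euler_coeff_eq:
  "q_binom_coeff 1 0 (q\<^sup>2) n * (q\<^sup>2) ^ n = (- 1) ^ n * q ^ (n * (n + 1)) / q_poch (q\<^sup>2) (q\<^sup>2) n"
proof (induction n)
  case (Suc n)
  have "q_binom_coeff 1 0 (q\<^sup>2) (Suc n) * (q\<^sup>2) ^ Suc n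
      = (q_binom_coeff 1 0 (q\<^sup>2) n * (q\<^sup>2) ^ n) * (- ((q\<^sup>2) ^ Suc n) / (1 - (q\<^sup>2) ^ Suc n))"
    by (simp add: q_binom_coeff_Suc mult_ac)
  also have "\<dots> = (- 1) ^ Suc n * (q ^ (n * (n + 1)) * (q\<^sup>2) ^ Suc n)
      / (q_poch (q\<^sup>2) (q\<^sup>2) n * (1 - (q\<^sup>2) ^ Suc n))"
    unfolding Suc.IH by simp
  also have "q ^ (n * (n + 1)) * (q\<^sup>2) ^ Suc n = q ^ (Suc n * (Suc n + 1))"
  proof -
    have "n * (n + 1) + 2 * Suc n = Suc n * (Suc n + 1)" by simp
    then show ?thesis by (metis power_add power_mult)
  qed
  finally show ?case by (simp add: q_poch_Suc)
qed simp

text \<open>The factorials in the denominator never fall below (\<beta>;p)_inf > 0, so an absolute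
  Euler series dominates. The index function \<open>k\<close> and the shift \<open>j\<close> cover
  the even and the odd series at once.\<close>

lemma summable_dk:
  fixes u :: complex
  assumes "0 \<le> \<beta>" "\<beta> < 1"
  shows "summable (\<lambda>n. norm (of_real (q_binom_coeff 1 0 (q\<^sup>2) n * (q\<^sup>2) ^ n / q_poch \<beta> (q\<^sup>2) (k n))
           * u ^ (2 * n + j)))"
proof (rule summable_comparison_test)
  let ?b = "\<lambda>n. cmod u ^ j / q_poch_inf \<beta> (q\<^sup>2)
    * (\<bar>q_binom_coeff 1 0 (q\<^sup>2) n\<bar> * (q\<^sup>2 * (cmod u)\<^sup>2) ^ n)"
  show "summable ?b" by (intro summable_mult summable_abs_Euler q_square_bounds)
  show "\<exists>N. \<forall>n\<ge>N. norm (norm (of_real (q_binom_coeff 1 0 (q\<^sup>2) n * (q\<^sup>2) ^ n / q_poch \<beta> (q\<^sup>2) (k n))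
           * u ^ (2 * n + j))) \<le> ?b n"
  proof (intro exI allI impI)
    fix n
    have pos: "0 < q_poch_inf \<beta> (q\<^sup>2)" "0 < q_poch \<beta> (q\<^sup>2) (k n)"
      using assms by (auto intro!: q_poch_inf_pos q_poch_pos q_square_bounds)
    have "inverse (q_poch \<beta> (q\<^sup>2) (k n)) \<le> inverse (q_poch_inf \<beta> (q\<^sup>2))"
      using assms pos by (intro le_imp_inverse_le q_poch_inf_le_q_poch q_square_bounds) auto
    then have "cmod u ^ j * (\<bar>q_binom_coeff 1 0 (q\<^sup>2) n\<bar> * (q\<^sup>2 * (cmod u)\<^sup>2) ^ n) * inverse (q_poch \<beta> (q\<^sup>2) (k n))
        \<le> cmod u ^ j * (\<bar>q_binom_coeff 1 0 (q\<^sup>2) n\<bar> * (q\<^sup>2 * (cmod u)\<^sup>2) ^ n) * inverse (q_poch_inf \<beta> (q\<^sup>2))"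
      by (intro mult_left_mono) auto
    moreover have "norm (of_real (q_binom_coeff 1 0 (q\<^sup>2) n * (q\<^sup>2) ^ n / q_poch \<beta> (q\<^sup>2) (k n)) * u ^ (2 * n + j))
        = cmod u ^ j * (\<bar>q_binom_coeff 1 0 (q\<^sup>2) n\<bar> * (q\<^sup>2 * (cmod u)\<^sup>2) ^ n) * inverse (q_poch \<beta> (q\<^sup>2) (k n))"
    proof -
      have "\<bar>q_binom_coeff 1 0 (q\<^sup>2) n * (q\<^sup>2) ^ n / q_poch \<beta> (q\<^sup>2) (k n)\<bar>
          = \<bar>q_binom_coeff 1 0 (q\<^sup>2) n\<bar> * (q\<^sup>2) ^ n * inverse (q_poch \<beta> (q\<^sup>2) (k n))"
        using pos by (simp add: abs_mult divide_inverse)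
      moreover have "cmod u ^ (2 * n + j) = cmod u ^ j * ((cmod u)\<^sup>2) ^ n"
        unfolding power_add power_mult by (rule mult.commute)
      ultimately show ?thesis
        unfolding norm_mult norm_of_real norm_power power_mult_distrib by (simp only: mult_ac)
    qed
    ultimately have "norm (of_real (q_binom_coeff 1 0 (q\<^sup>2) n * (q\<^sup>2) ^ n / q_poch \<beta> (q\<^sup>2) (k n)) * u ^ (2 * n + j))
        \<le> cmod u ^ j * (\<bar>q_binom_coeff 1 0 (q\<^sup>2) n\<bar> * (q\<^sup>2 * (cmod u)\<^sup>2) ^ n) * inverse (q_poch_inf \<beta> (q\<^sup>2))"
      by (simp only:)
    then show "norm (norm (of_real (q_binom_coeff 1 0 (q\<^sup>2) n * (q\<^sup>2) ^ n / q_poch \<beta> (q\<^sup>2) (k n)) * u ^ (2 * n + j))) \<le> ?b n"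
      unfolding real_norm_def abs_norm_cancel by (simp only: divide_inverse mult_ac)
  qed
qed

lemma summable_dk_even:
  fixes u :: complex
  assumes "0 \<le> \<beta>" "\<beta> < 1"
  shows "summable (\<lambda>n. of_real (q_binom_coeff 1 0 (q\<^sup>2) n * (q\<^sup>2) ^ n / q_poch \<beta> (q\<^sup>2) n) * u ^ (2 * n))"
  using summable_norm_cancel[OF summable_dk[OF assms, of "\<lambda>n. n" u 0]] by simp

lemma summable_dk_odd:
  fixes u :: complex
  assumes "0 \<le> \<beta>" "\<beta> < 1"
  shows "summable (\<lambda>n. of_real (q_binom_coeff 1 0 (q\<^sup>2) n * (q\<^sup>2) ^ n / q_poch \<beta> (q\<^sup>2) (Suc n)) * u ^ (2 * n + 1))"
  using summable_norm_cancel[OF summable_dk[OF assms, of Suc u 1]] by simp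

lemma dk_odd_minus:
  assumes "0 \<le> \<beta>" "\<beta> < 1"
  shows "dk_odd q \<beta> (- u) = - dk_odd q \<beta> u"
  using suminf_minus[OF summable_dk_odd[OF assms, of u]] by (simp add: dk_odd_def)

text \<open>Multiplying the series by (\<beta>;p)_inf turns 1 / (\<beta>;p)_n into (\<beta>
  p^n;p)_inf, which gives the terms of \<open>phi11\<close>.\<close>

lemma dk_even_of_real:
  assumes "0 \<le> \<beta>" "\<beta> < 1"
  shows "dk_even q \<beta> (of_real r) = of_real (phi11 (q\<^sup>2) \<beta> (q\<^sup>2 * r\<^sup>2) / q_poch_inf \<beta> (q\<^sup>2))"
proof -
  let ?P = "q_poch_inf \<beta> (q\<^sup>2)"
  let ?g = "\<lambda>n. q_binom_coeff 1 0 (q\<^sup>2) n * (q\<^sup>2) ^ n / q_poch \<beta> (q\<^sup>2) n * r ^ (2 * n)"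
  have P: "0 < ?P" using assms by (intro q_poch_inf_pos q_square_bounds)
  have "summable (\<lambda>n. complex_of_real (?g n))"
    using summable_dk_even[OF assms, of "of_real r"] by simp
  then have g: "summable ?g" by (simp only: summable_complex_of_real)
  have "phi11 (q\<^sup>2) \<beta> (q\<^sup>2 * r\<^sup>2) = (\<Sum>n. ?P * ?g n)"
    unfolding phi11_def
  proof (intro suminf_cong)
    fix n
    have "q_poch \<beta> (q\<^sup>2) n \<noteq> 0" using q_poch_pos[OF q_square_bounds assms(2), of n] by simp
    then have "?P * ?g n
        = q_binom_coeff 1 0 (q\<^sup>2) n * (q\<^sup>2) ^ n * r ^ (2 * n) * q_poch_inf (\<beta> * (q\<^sup>2) ^ n) (q\<^sup>2)"
      by (simp add: q_poch_inf_split[OF q_square_bounds, of \<beta> n])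
    then show "q_binom_coeff 1 0 (q\<^sup>2) n * (q\<^sup>2 * r\<^sup>2) ^ n * q_poch_inf (\<beta> * (q\<^sup>2) ^ n) (q\<^sup>2) = ?P * ?g n"
      unfolding power_mult[of r 2] power_mult_distrib by (simp only: mult_ac)
  qed
  also have "\<dots> = ?P * (\<Sum>n. ?g n)" using g by (rule suminf_mult)
  finally have "phi11 (q\<^sup>2) \<beta> (q\<^sup>2 * r\<^sup>2) / ?P = (\<Sum>n. ?g n)" using P by simp
  moreover have "dk_even q \<beta> (of_real r) = of_real (\<Sum>n. ?g n)"
    unfolding dk_even_def suminf_of_real[OF g] by simp
  ultimately show ?thesis by simp
qed

text \<open>The denominator has one factor more than in the even case, which replaces
  \<open>\<beta>\<close> by \<open>\<beta> * q\<^sup>2\<close>; the odd power leaves an extra factor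
  \<open>r\<close>.\<close>

lemma dk_odd_of_real:
  assumes "0 \<le> \<beta>" "\<beta> < 1"
  shows "dk_odd q \<beta> (of_real r) = of_real (r * phi11 (q\<^sup>2) (\<beta> * q\<^sup>2) (q\<^sup>2 * r\<^sup>2) / q_poch_inf \<beta> (q\<^sup>2))"
proof -
  let ?P = "q_poch_inf \<beta> (q\<^sup>2)"
  let ?h = "\<lambda>n. q_binom_coeff 1 0 (q\<^sup>2) n * (q\<^sup>2 * r\<^sup>2) ^ n * q_poch_inf (\<beta> * q\<^sup>2 * (q\<^sup>2) ^ n) (q\<^sup>2)"
  let ?g = "\<lambda>n. q_binom_coeff 1 0 (q\<^sup>2) n * (q\<^sup>2) ^ n / q_poch \<beta> (q\<^sup>2) (Suc n) * r ^ (2 * n + 1)"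
  have P: "0 < ?P" using assms by (intro q_poch_inf_pos q_square_bounds)
  have "summable (\<lambda>n. complex_of_real (?g n))"
    using summable_dk_odd[OF assms, of "of_real r"] by simp
  then have g: "summable ?g" by (simp only: summable_complex_of_real)
  have gh: "r * ?h n = ?P * ?g n" for n
  proof -
    have "q_poch \<beta> (q\<^sup>2) (Suc n) \<noteq> 0" using q_poch_pos[OF q_square_bounds assms(2), of "Suc n"] by simp
    then have "?P * ?g n = q_binom_coeff 1 0 (q\<^sup>2) n * (q\<^sup>2) ^ n * r ^ (2 * n + 1)
        * q_poch_inf (\<beta> * (q\<^sup>2) ^ Suc n) (q\<^sup>2)"
      by (simp only: q_poch_inf_split[OF q_square_bounds, of \<beta> "Suc n"]) simp
    then show ?thesis
      unfolding power_add power_mult[of r 2] power_mult_distrib power_one_right power_Suc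
      by (simp only: mult_ac)
  qed
  have "r * phi11 (q\<^sup>2) (\<beta> * q\<^sup>2) (q\<^sup>2 * r\<^sup>2) = ?P * (\<Sum>n. ?g n)"
  \<comment> \<open>Summability of \<open>?h\<close> is obtained from that of \<open>?g\<close> by
    dividing by \<open>r\<close>, so \<open>r = 0\<close> is treated apart.\<close>
  proof (cases "r = 0")
    case False
    have "?h = (\<lambda>n. (?P / r) * ?g n)"
    proof
      fix n
      have "?h n = r * ?h n / r" using False by simp
      then show "?h n = (?P / r) * ?g n" unfolding gh by simp
    qed
    then have "summable ?h" using summable_mult[OF g, of "?P / r"] by simp
    then have "r * phi11 (q\<^sup>2) (\<beta> * q\<^sup>2) (q\<^sup>2 * r\<^sup>2) = (\<Sum>n. r * ?h n)"
      unfolding phi11_def by (rule suminf_mult[symmetric])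
    also have "\<dots> = ?P * (\<Sum>n. ?g n)" unfolding gh using g by (rule suminf_mult)
    finally show ?thesis .
  qed simp
  then have "r * phi11 (q\<^sup>2) (\<beta> * q\<^sup>2) (q\<^sup>2 * r\<^sup>2) / ?P = (\<Sum>n. ?g n)" using P by simp
  moreover have "dk_odd q \<beta> (of_real r) = of_real (\<Sum>n. ?g n)"
    unfolding dk_odd_def suminf_of_real[OF g] by simp
  ultimately show ?thesis by simp
qed

text \<open>By symmetry the parameter \<open>w\<close> and the argument may be exchanged; then the terms with index below
  \<open>- s\<close> vanish, and in the others \<open>q powi s\<close> is dominated by \<open>1 / q ^ n\<close>.\<close>

lemma phi11_powi_bound:
  assumes "0 \<le> w"
  shows "(q powi s) ^ m * \<bar>phi11 (q\<^sup>2) w (q\<^sup>2 * (q powi s)\<^sup>2)\<bar> \<le> q_poch_inf (- (w / q ^ m)) (q\<^sup>2)"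
proof -
  let ?e = "q_binom_coeff 1 0 (q\<^sup>2)"
  let ?f = "\<lambda>n. (q powi s) ^ m * (?e n * w ^ n * q_poch_inf (q\<^sup>2 * (q powi s)\<^sup>2 * (q\<^sup>2) ^ n) (q\<^sup>2))"
  \<comment> \<open>After the exchange, the parameter of each infinite product is an integer power
    of the base, so the product vanishes once the exponent is not positive.\<close>
  have arg: "q\<^sup>2 * (q powi s)\<^sup>2 * (q\<^sup>2) ^ n = q\<^sup>2 powi (1 + s + int n)" for n
  proof -
    have "(q powi s)\<^sup>2 = q\<^sup>2 powi s"
      by (simp add: power_int_mult_distrib power2_eq_square)
    then show ?thesis using q by (simp add: power_int_add)
  qed
  have le: "\<bar>?f n\<bar> \<le> \<bar>?e n\<bar> * (w / q ^ m) ^ n" for n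
  proof (cases "1 + s + int n \<le> 0")
    case True
    then have "?f n = 0" unfolding arg by (simp add: q_poch_inf_powi_nonpos[OF q_square_bounds])
    then have "\<bar>?f n\<bar> = 0" by (simp only: abs_zero)
    also have "0 \<le> \<bar>?e n\<bar> * (w / q ^ m) ^ n" using assms q by simp
    finally show ?thesis .
  next
    case False
    then have "q powi s \<le> q powi (- int n)"
      using q by (intro power_int_decreasing) auto
    then have "q powi s \<le> 1 / q ^ n" by (simp add: power_int_minus divide_inverse)
    then have "(q powi s) ^ m \<le> (1 / q ^ n) ^ m" using q by (intro power_mono) auto
    also have "\<dots> = (1 / q ^ m) ^ n" by (simp add: power_divide power_mult[symmetric] mult.commute)
    finally have 1: "(q powi s) ^ m \<le> (1 / q ^ m) ^ n" .
    have "\<bar>?f n\<bar> = (q powi s) ^ m * (\<bar>?e n\<bar> * w ^ n) * q_poch_inf (q\<^sup>2 powi (1 + s + int n)) (q\<^sup>2)"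
      using q assms q_poch_inf_powi_bounds(1)[OF q_square_bounds, of "1 + s + int n"]
      unfolding arg by (simp add: abs_mult)
    also have "\<dots> \<le> (q powi s) ^ m * (\<bar>?e n\<bar> * w ^ n) * 1"
      using q assms q_poch_inf_powi_bounds(2)[OF q_square_bounds, of "1 + s + int n"]
      by (intro mult_left_mono) auto
    also have "\<dots> \<le> (1 / q ^ m) ^ n * (\<bar>?e n\<bar> * w ^ n)"
      using 1 assms by (simp only: mult_1_right) (intro mult_right_mono; simp)
    also have "\<dots> = \<bar>?e n\<bar> * (w / q ^ m) ^ n" by (simp add: power_divide)
    finally show ?thesis .
  qed
  note sums = summable_abs_Euler[OF q_square_bounds, of "w / q ^ m"]
  have sf: "summable (\<lambda>n. \<bar>?f n\<bar>)"
    by (rule summable_comparison_test[OF _ sums]) (use le in auto)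
  have "(q powi s) ^ m * phi11 (q\<^sup>2) w (q\<^sup>2 * (q powi s)\<^sup>2) = (\<Sum>n. ?f n)"
  proof -
    have "(q powi s) ^ m \<noteq> 0" using q by simp
    moreover have "summable ?f" using sf by (rule summable_rabs_cancel)
    ultimately show ?thesis
      unfolding phi11_commute[OF q_square_bounds, of w] unfolding phi11_def
      by (subst suminf_mult[symmetric]) (auto simp: summable_cmult_iff)
  qed
  then have "(q powi s) ^ m * \<bar>phi11 (q\<^sup>2) w (q\<^sup>2 * (q powi s)\<^sup>2)\<bar> = \<bar>\<Sum>n. ?f n\<bar>"
    using q by (simp add: abs_mult flip: \<open>_ = (\<Sum>n. ?f n)\<close>)
  also have "\<dots> \<le> (\<Sum>n. \<bar>?f n\<bar>)" using sf by (rule summable_rabs)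
  also have "\<dots> \<le> (\<Sum>n. \<bar>?e n\<bar> * (w / q ^ m) ^ n)" using sf sums le by (intro suminf_le)
  also have "\<dots> = q_poch_inf (- (w / q ^ m)) (q\<^sup>2)" by (rule abs_Euler_series[OF q_square_bounds])
  finally show ?thesis .
qed

section \<open>Explicit bounds on \<open>Rq\<close>\<close>

lemma dk_even_powi_bound:
  assumes "0 \<le> \<beta>" "\<beta> < 1"
  shows "(q powi s) ^ m * cmod (dk_even q \<beta> (of_real (q powi s)))
       \<le> q_poch_inf (- (\<beta> / q ^ m)) (q\<^sup>2) / q_poch_inf \<beta> (q\<^sup>2)"
  using phi11_powi_bound[OF assms(1), of s m] q_poch_inf_pos[OF q_square_bounds assms]
  unfolding dk_even_of_real[OF assms] norm_of_real by (simp add: divide_right_mono)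

text \<open>The extra factor of the odd part raises the weight from power \<open>m\<close> to
  \<open>Suc m\<close>.\<close>

lemma dk_odd_powi_bound:
  assumes "0 \<le> \<beta>" "\<beta> < 1"
  shows "(q powi s) ^ m * cmod (dk_odd q \<beta> (of_real (q powi s)))
       \<le> q_poch_inf (- (\<beta> * q\<^sup>2 / q ^ Suc m)) (q\<^sup>2) / q_poch_inf \<beta> (q\<^sup>2)"
proof -
  have "cmod (dk_odd q \<beta> (of_real (q powi s)))
      = q powi s * \<bar>phi11 (q\<^sup>2) (\<beta> * q\<^sup>2) (q\<^sup>2 * (q powi s)\<^sup>2)\<bar> / q_poch_inf \<beta> (q\<^sup>2)"
    unfolding dk_odd_of_real[OF assms] norm_of_real
    using q_poch_inf_pos[OF q_square_bounds assms] q by (simp add: abs_mult)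
  moreover have "0 \<le> \<beta> * q\<^sup>2" using assms by simp
  ultimately show ?thesis
    using phi11_powi_bound[of "\<beta> * q\<^sup>2" s "Suc m"] q_poch_inf_pos[OF q_square_bounds assms]
    by (simp add: divide_right_mono mult_ac)
qed

text \<open>The factors 1 - q^(2k+1) and 1 - q^(2k+2) are collected separately.\<close>

lemma q_poch_double: "q_poch q q (2 * n) = q_poch q (q\<^sup>2) n * q_poch (q\<^sup>2) (q\<^sup>2) n"
proof (induction n)
  case (Suc n)
  have "q_poch q q (2 * Suc n) = q_poch q q (2 * n) * (1 - q * q ^ (2 * n)) * (1 - q * (q * q ^ (2 * n)))"
    by (simp add: q_poch_Suc)
  also have "q ^ (2 * n) = (q\<^sup>2) ^ n" by (rule power_mult)
  finally show ?case
    unfolding Suc.IH q_poch_Suc by (simp only: power2_eq_square mult_ac)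
qed simp

lemma q_poch_inf_q_eq: "q_poch_inf q q = q_poch_inf q (q\<^sup>2) * q_poch_inf (q\<^sup>2) (q\<^sup>2)"
proof -
  have "(\<lambda>n. q_poch q q (2 * n)) \<longlonglongrightarrow> q_poch_inf q q"
    using LIMSEQ_subseq_LIMSEQ[OF q_poch_LIMSEQ[OF q, of q], of "\<lambda>n. 2 * n"]
    by (auto simp: strict_mono_def o_def)
  moreover have "(\<lambda>n. q_poch q q (2 * n)) \<longlonglongrightarrow> q_poch_inf q (q\<^sup>2) * q_poch_inf (q\<^sup>2) (q\<^sup>2)"
    unfolding q_poch_double by (intro tendsto_mult q_poch_LIMSEQ q_square_bounds)
  ultimately show ?thesis by (rule LIMSEQ_unique)
qed

text \<open>Once the first factor 1 + q is split off, each 1 - p^k is paired with 1 + q p^k, where p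
  = q^2; such a pair is at most 1. What remains is 1 + q, which is below 2.\<close>

lemma q_poch_inf_minus_q_le: "q_poch_inf (- q) (q\<^sup>2) * q_poch_inf (q\<^sup>2) (q\<^sup>2) \<le> 2"
proof (rule LIMSEQ_le_const2)
  show "(\<lambda>n. q_poch (- q) (q\<^sup>2) n * q_poch (q\<^sup>2) (q\<^sup>2) n)
      \<longlonglongrightarrow> q_poch_inf (- q) (q\<^sup>2) * q_poch_inf (q\<^sup>2) (q\<^sup>2)"
    by (intro tendsto_mult q_poch_LIMSEQ q_square_bounds)
  \<comment> \<open>The factor \<open>1 + q * (q\<^sup>2) ^ n\<close> belongs to the induction
    hypothesis so that each step multiplies by one complete pair.\<close>
  have "q_poch (- q) (q\<^sup>2) n * q_poch (q\<^sup>2) (q\<^sup>2) n * (1 + q * (q\<^sup>2) ^ n) \<le> 1 + q \<and>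
        0 \<le> q_poch (- q) (q\<^sup>2) n * q_poch (q\<^sup>2) (q\<^sup>2) n" for n
  proof (induction n)
    case (Suc n)
    let ?x = "(q\<^sup>2) ^ Suc n"
    have x: "0 \<le> ?x" "?x \<le> 1" using power_base_bounds[OF q_square_bounds, of "Suc n"] by auto
    have "(1 - ?x) * (1 + q * ?x) = 1 - (1 - q) * ?x - q * ?x * ?x" by (simp add: algebra_simps)
    also have "\<dots> \<le> 1"
    proof -
      have "0 \<le> (1 - q) * ?x" "0 \<le> q * ?x * ?x" using x q by auto
      then show ?thesis by linarith
    qed
    finally have "(1 - ?x) * (1 + q * ?x) \<le> 1" .
    let ?Q = "q_poch (- q) (q\<^sup>2) n * q_poch (q\<^sup>2) (q\<^sup>2) n * (1 + q * (q\<^sup>2) ^ n)"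
    have Q: "0 \<le> ?Q" "?Q \<le> 1 + q" using Suc.IH q by auto
    have eq: "q_poch (- q) (q\<^sup>2) (Suc n) * q_poch (q\<^sup>2) (q\<^sup>2) (Suc n) = ?Q * (1 - ?x)"
      by (simp add: q_poch_Suc mult_ac)
    have "?Q * ((1 - ?x) * (1 + q * ?x)) \<le> ?Q * 1"
      using \<open>(1 - ?x) * (1 + q * ?x) \<le> 1\<close> Q(1) by (rule mult_left_mono)
    moreover have "0 \<le> ?Q * (1 - ?x)" by (rule mult_nonneg_nonneg) (use Q(1) x in auto)
    ultimately show ?case unfolding eq mult.assoc[of ?Q] using Q by linarith
  qed (use q in simp)
  then have *: "q_poch (- q) (q\<^sup>2) n * q_poch (q\<^sup>2) (q\<^sup>2) n * (1 + q * (q\<^sup>2) ^ n) \<le> 1 + q"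
     "0 \<le> q_poch (- q) (q\<^sup>2) n * q_poch (q\<^sup>2) (q\<^sup>2) n" for n by auto
  have "q_poch (- q) (q\<^sup>2) n * q_poch (q\<^sup>2) (q\<^sup>2) n \<le> 2" for n
  proof -
    have "q_poch (- q) (q\<^sup>2) n * q_poch (q\<^sup>2) (q\<^sup>2) n * 1
        \<le> q_poch (- q) (q\<^sup>2) n * q_poch (q\<^sup>2) (q\<^sup>2) n * (1 + q * (q\<^sup>2) ^ n)"
      using *(2) q by (intro mult_left_mono) auto
    then show ?thesis using *(1)[of n] q by linarith
  qed
  then show "\<exists>N. \<forall>n\<ge>N. q_poch (- q) (q\<^sup>2) n * q_poch (q\<^sup>2) (q\<^sup>2) n \<le> 2" by blast
qed

text \<open>Multiplying factor by factor gives (1 + p^k)(1 - p^k) = 1 - p^(2k), again with p =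
  q^2.\<close>

lemma q_poch_inf_minus_q_square_le: "q_poch_inf (- (q\<^sup>2)) (q\<^sup>2) * q_poch_inf (q\<^sup>2) (q\<^sup>2) \<le> 1"
proof (rule LIMSEQ_le_const2)
  show "(\<lambda>n. q_poch (- (q\<^sup>2)) (q\<^sup>2) n * q_poch (q\<^sup>2) (q\<^sup>2) n)
      \<longlonglongrightarrow> q_poch_inf (- (q\<^sup>2)) (q\<^sup>2) * q_poch_inf (q\<^sup>2) (q\<^sup>2)"
    by (intro tendsto_mult q_poch_LIMSEQ q_square_bounds)
  have "q_poch (- (q\<^sup>2)) (q\<^sup>2) n * q_poch (q\<^sup>2) (q\<^sup>2) n \<le> 1" for n
  proof -
    have "q_poch (- (q\<^sup>2)) (q\<^sup>2) n * q_poch (q\<^sup>2) (q\<^sup>2) n = (\<Prod>k<n. 1 - ((q\<^sup>2) ^ Suc k)\<^sup>2)"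
      by (simp add: q_poch_def prod.distrib[symmetric] algebra_simps power2_eq_square)
    also have "\<dots> \<le> 1"
    proof (rule prod_le_1)
      fix k
      show "0 \<le> 1 - ((q\<^sup>2) ^ Suc k)\<^sup>2 \<and> 1 - ((q\<^sup>2) ^ Suc k)\<^sup>2 \<le> 1"
        using power_base_bounds[OF q_square_bounds, of "Suc k"] by (simp add: power_le_one)
    qed
    finally show ?thesis .
  qed
  then show "\<exists>N. \<forall>n\<ge>N. q_poch (- (q\<^sup>2)) (q\<^sup>2) n * q_poch (q\<^sup>2) (q\<^sup>2) n \<le> 1" by blast
qed

text \<open>The even part contributes 2 and the odd part 1, once both are put over (q;q)_inf =
  (q;q^2)_inf (q^2;q^2)_inf.\<close>

lemma q_exp_Rq_bound:
  assumes "u \<in> Rq q"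
  shows "cmod (dk q q u) \<le> 3 / q_poch_inf q q"
proof -
  obtain s where u: "u = of_real (q powi s) \<or> u = - of_real (q powi s)"
    using assms by (auto simp: Rq_def)
  have q0: "0 \<le> q" using q by simp
  have pos: "0 < q_poch_inf q (q\<^sup>2)" "0 < q_poch_inf (q\<^sup>2) (q\<^sup>2)"
    using q by (auto intro!: q_poch_inf_pos q_square_bounds simp: power_less_one_iff)
  have "cmod (dk_even q q (of_real (q powi s))) \<le> q_poch_inf (- q) (q\<^sup>2) / q_poch_inf q (q\<^sup>2)"
    using dk_even_powi_bound[OF q0 q(2), of s 0] by simp
  also have "\<dots> \<le> 2 / q_poch_inf q q"
    using q_poch_inf_minus_q_le pos by (simp add: q_poch_inf_q_eq field_simps)
  finally have even: "cmod (dk_even q q (of_real (q powi s))) \<le> 2 / q_poch_inf q q" .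
  \<comment> \<open>For \<open>\<beta> = q\<close> and weight exponent 0 the parameter
    \<open>\<beta> * q\<^sup>2 / q ^ Suc 0\<close> is just \<open>q\<^sup>2\<close>.\<close>
  have "cmod (dk_odd q q (of_real (q powi s))) \<le> q_poch_inf (- (q\<^sup>2)) (q\<^sup>2) / q_poch_inf q (q\<^sup>2)"
    using dk_odd_powi_bound[OF q0 q(2), of s 0] q by simp
  also have "\<dots> \<le> 1 / q_poch_inf q q"
    using q_poch_inf_minus_q_square_le pos by (simp add: q_poch_inf_q_eq field_simps)
  finally have odd: "cmod (dk_odd q q (of_real (q powi s))) \<le> 1 / q_poch_inf q q" .
  have "cmod (dk q q u) \<le> cmod (dk_even q q u) + cmod (dk_odd q q u)"
    unfolding dk_def using norm_triangle_ineq[of "dk_even q q u" "\<i> * dk_odd q q u"]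
    by (simp add: norm_mult)
  also have "\<dots> = cmod (dk_even q q (of_real (q powi s))) + cmod (dk_odd q q (of_real (q powi s)))"
    using u by (auto simp only: dk_even_minus dk_odd_minus[OF q0 q(2)] norm_minus_cancel)
  finally show ?thesis using even odd by (simp add: add_divide_distrib[symmetric])
qed

text \<open>The bounds for both parts hold for every weight exponent \<open>m\<close> and do not
  involve \<open>s\<close>.\<close>

lemma dk_Rq_decay:
  assumes "0 \<le> \<beta>" "\<beta> < 1"
  obtains B where "\<And>u. u \<in> Rq q \<Longrightarrow> cmod u ^ m * cmod (dk q \<beta> u) \<le> B"
proof
  fix u assume "u \<in> Rq q"
  then obtain s where u: "u = of_real (q powi s) \<or> u = - of_real (q powi s)"
    by (auto simp: Rq_def)
  have nu: "cmod u = q powi s"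
    using u q by (auto simp only: norm_minus_cancel norm_of_real abs_of_pos zero_less_power_int)
  have "cmod (dk q \<beta> u) \<le> cmod (dk_even q \<beta> u) + cmod (dk_odd q \<beta> u)"
    unfolding dk_def using norm_triangle_ineq[of "dk_even q \<beta> u" "\<i> * dk_odd q \<beta> u"]
    by (simp add: norm_mult)
  also have "\<dots> = cmod (dk_even q \<beta> (of_real (q powi s))) + cmod (dk_odd q \<beta> (of_real (q powi s)))"
    using u by (auto simp only: dk_even_minus dk_odd_minus[OF assms] norm_minus_cancel)
  finally have "cmod u ^ m * cmod (dk q \<beta> u) \<le>
     (q powi s) ^ m * cmod (dk_even q \<beta> (of_real (q powi s))) +
     (q powi s) ^ m * cmod (dk_odd q \<beta> (of_real (q powi s)))"
    unfolding nu distrib_left[symmetric] using q by (intro mult_left_mono) auto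
  also have "\<dots> \<le> q_poch_inf (- (\<beta> / q ^ m)) (q\<^sup>2) / q_poch_inf \<beta> (q\<^sup>2)
     + q_poch_inf (- (\<beta> * q\<^sup>2 / q ^ Suc m)) (q\<^sup>2) / q_poch_inf \<beta> (q\<^sup>2)"
    by (intro add_mono dk_even_powi_bound dk_odd_powi_bound assms)
  finally show "cmod u ^ m * cmod (dk q \<beta> u) \<le> q_poch_inf (- (\<beta> / q ^ m)) (q\<^sup>2) / q_poch_inf \<beta> (q\<^sup>2)
     + q_poch_inf (- (\<beta> * q\<^sup>2 / q ^ Suc m)) (q\<^sup>2) / q_poch_inf \<beta> (q\<^sup>2)" .
qed

end

section \<open>The kernel and the q-exponential as normalised series\<close>

lemma q_Gamma_ratio:
  assumes p: "0 < p" "p < 1" and x: "0 < x"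
  shows "q_Gamma p x / q_Gamma p (x + real n) = (1 - p) ^ n / q_poch (p powr x) p n"
proof -
  have px: "0 \<le> p powr x" "p powr x < 1" using p x powr_less_mono'[of p 0 x] by auto
  have pxn: "p powr (x + real n) = p powr x * p ^ n" using p by (simp add: powr_add powr_realpow)
  have "p powr x * p ^ n < 1"
    using px p powr_less_mono'[of p 0 "x + real n"] x by (simp flip: pxn)
  then have pos: "0 < q_poch_inf (p powr x * p ^ n) p" "0 < q_poch (p powr x) p n" "0 < q_poch_inf p p"
    using px p by (auto intro!: q_poch_inf_pos q_poch_pos)
  have "(1 - p) powr (1 - (x + real n)) = (1 - p) powr (1 - x) / (1 - p) ^ n"
    using p powr_diff[of "1 - p" "1 - x" "real n"] by (simp add: powr_realpow algebra_simps)
  then show ?thesis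
    using p pos by (simp add: q_Gamma_def pxn q_poch_inf_split[OF p, of "p powr x" n])
qed

lemma q_Gamma_1:
  assumes "0 < p" "p < 1"
  shows "q_Gamma p 1 = 1"
  using assms q_poch_inf_pos[OF assms, of p] by (simp add: q_Gamma_def)

context
  fixes q :: real
  assumes q: "0 < q" "q < 1"
begin

lemma q_square_powr: "q\<^sup>2 powr x = q powr (2 * x)"
proof -
  have "q\<^sup>2 = q powr 2" using q powr_realpow[of q 2] by simp
  then show ?thesis using q by (simp only: powr_powr)
qed

text \<open>The two Gamma quotients contribute (1 - q^2)^(2n); together with the division of the
  argument by 1 + q this leaves (1 - q)^(2n), which is absorbed by rescaling the argument.\<close>

lemma q_j_eq_dk_even:
  assumes "- 1 < \<alpha>"
  shows "q_j \<alpha> q y = dk_even q (q powr (2 * \<alpha> + 2)) ((1 - of_real q) * y)"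
  unfolding q_j_def dk_even_def
proof (intro suminf_cong)
  fix n
  note p = q_square_bounds[OF q]
  let ?Q = "q_poch (q powr (2 * \<alpha> + 2)) (q\<^sup>2) n"
  let ?P = "q_poch (q\<^sup>2) (q\<^sup>2) n"
  have ratio: "q_Gamma (q\<^sup>2) (\<alpha> + 1) / q_Gamma (q\<^sup>2) (\<alpha> + real n + 1) = (1 - q\<^sup>2) ^ n / ?Q"
    using q_Gamma_ratio[OF p, of "\<alpha> + 1" n] assms by (simp add: q_square_powr algebra_simps)
  have inv: "1 / q_Gamma (q\<^sup>2) (real n + 1) = (1 - q\<^sup>2) ^ n / ?P"
    using q_Gamma_ratio[OF p, of 1 n] q q_Gamma_1[OF p] by (simp add: algebra_simps)
  have "q_Gamma (q\<^sup>2) (\<alpha> + 1) * q ^ (n * (n + 1))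
                   / (q_Gamma (q\<^sup>2) (\<alpha> + real n + 1) * q_Gamma (q\<^sup>2) (real n + 1))
      = q_Gamma (q\<^sup>2) (\<alpha> + 1) / q_Gamma (q\<^sup>2) (\<alpha> + real n + 1) * (1 / q_Gamma (q\<^sup>2) (real n + 1)) * q ^ (n * (n + 1))"
    by simp
  also have "\<dots> = (1 - q\<^sup>2) ^ n / ?Q * ((1 - q\<^sup>2) ^ n / ?P) * q ^ (n * (n + 1))"
    unfolding ratio inv by simp
  also have "\<dots> = (1 - q\<^sup>2) ^ (2 * n) * (q ^ (n * (n + 1)) / (?Q * ?P))"
    unfolding mult_2[of n] power_add by (simp only: times_divide_eq_left times_divide_eq_right divide_divide_eq_left mult_ac)
  finally have G: "q_Gamma (q\<^sup>2) (\<alpha> + 1) * q ^ (n * (n + 1))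
                   / (q_Gamma (q\<^sup>2) (\<alpha> + real n + 1) * q_Gamma (q\<^sup>2) (real n + 1))
      = (1 - q\<^sup>2) ^ (2 * n) * (q ^ (n * (n + 1)) / (?Q * ?P))" .
  have nz: "1 + complex_of_real q \<noteq> 0"
    using q by (metis of_real_1 of_real_add of_real_eq_0_iff add_pos_pos less_irrefl zero_less_one)
  have "of_real ((1 - q\<^sup>2) ^ (2 * n)) * (y / (1 + of_real q)) ^ (2 * n) = ((1 - of_real q) * y) ^ (2 * n)"
  proof -
    have "complex_of_real (1 - q\<^sup>2) * (y / (1 + of_real q)) = (1 - of_real q) * y"
      using nz by (simp add: field_simps power2_eq_square)
    then show ?thesis by (metis of_real_power power_mult_distrib)
  qed
  moreover have "q_binom_coeff 1 0 (q\<^sup>2) n * (q\<^sup>2) ^ n / ?Q = (- 1) ^ n * (q ^ (n * (n + 1)) / (?Q * ?P))"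
    unfolding Euler_coeff_eq[OF q] by simp
  moreover have "(- 1) ^ n * of_real (a * b) * c = of_real ((- 1) ^ n * b) * (of_real a * c)"
    for a b and c :: complex by simp
  ultimately show "(-1) ^ n
        * of_real (q_Gamma (q\<^sup>2) (\<alpha> + 1) * q ^ (n * (n + 1))
                   / (q_Gamma (q\<^sup>2) (\<alpha> + real n + 1) * q_Gamma (q\<^sup>2) (real n + 1)))
        * (y / (1 + of_real q)) ^ (2 * n)
      = of_real (q_binom_coeff 1 0 (q\<^sup>2) n * (q\<^sup>2) ^ n / ?Q) * ((1 - of_real q) * y) ^ (2 * n)"
    unfolding G by (simp only:)
qed

text \<open>This rests on (\<beta>;p)_(n+1) = (1 - \<beta>) (\<beta> p;p)_n. Raising \<alpha> by one
  multiplies \<beta> by p = q^2, so the right-hand side is the second term of the kernel.\<close>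

lemma dk_odd_eq_dk_even:
  assumes "0 \<le> \<beta>" "\<beta> < 1"
  shows "dk_odd q \<beta> u = u / of_real (1 - \<beta>) * dk_even q (\<beta> * q\<^sup>2) u"
proof -
  have "\<beta> * q\<^sup>2 \<le> \<beta>" using assms q_square_bounds[OF q] by (intro mult_left_le) auto
  then have "0 \<le> \<beta> * q\<^sup>2" "\<beta> * q\<^sup>2 < 1" using assms by auto
  note s = summable_dk_even[OF q this, of u]
  show ?thesis
    unfolding dk_odd_def dk_even_def suminf_mult[OF s, symmetric] q_poch_Suc_shift
    by (intro suminf_cong) (simp add: mult_ac)
qed

lemma beta_bounds:
  assumes "- (1 / 2) \<le> \<alpha>"
  shows "0 \<le> q powr (2 * \<alpha> + 2)" "q powr (2 * \<alpha> + 2) < 1"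
  using q assms powr_less_mono'[of q 0 "2 * \<alpha> + 2"] by auto

lemma q_Dunkl_kernel_eq_dk:
  assumes "- (1 / 2) \<le> \<alpha>"
  shows "q_Dunkl_kernel \<alpha> q l x = dk q (q powr (2 * \<alpha> + 2)) ((1 - of_real q) * (l * x))"
proof -
  have "q powr (2 * (\<alpha> + 1) + 2) = q powr (2 * \<alpha> + 2) * q\<^sup>2"
    using q powr_add[of q "2 * \<alpha> + 2" 2] powr_realpow[of q 2] by (simp add: algebra_simps)
  then show ?thesis
    unfolding q_Dunkl_kernel_def dk_def dk_odd_eq_dk_even[OF beta_bounds[OF assms]] q_num_def
    using assms q q_j_eq_dk_even[of \<alpha> "l * x"] q_j_eq_dk_even[of "\<alpha> + 1" "l * x"]
    by simp
qed

lemma q_fact_eq: "q_fact q n = q_poch q q n / (1 - q) ^ n"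
proof (induction n)
  case (Suc n)
  have "q_fact q (Suc n) = q_fact q n * q_num q (real (Suc n))"
    by (simp add: q_fact_def)
  also have "q_num q (real (Suc n)) = (1 - q * q ^ n) / (1 - q)"
    using q by (simp add: q_num_def powr_realpow flip: of_nat_Suc power_Suc)
  finally show ?case by (simp add: Suc q_poch_Suc)
qed (simp add: q_fact_def)

text \<open>The factorial splits as (q;q)_(2n) = (q;p)_n (p;p)_n with p = q^2, which is the case
  \<beta> = q.\<close>

lemma q_cos_eq_dk_even: "q_cos q y = dk_even q q ((1 - of_real q) * y)"
  unfolding q_cos_def dk_even_def
proof (intro suminf_cong)
  fix n
  have "q_binom_coeff 1 0 (q\<^sup>2) n * (q\<^sup>2) ^ n / q_poch q (q\<^sup>2) n * (1 - q) ^ (2 * n)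
      = (- 1) ^ n * q ^ (n * (n + 1)) / q_fact q (2 * n)"
    unfolding Euler_coeff_eq[OF q] q_fact_eq q_poch_double[OF q] by simp
  moreover have "(- 1) ^ n * of_real r * y ^ (2 * n) / of_real F = of_real ((- 1) ^ n * r / F) * y ^ (2 * n)"
    for r F :: real by simp
  moreover have "of_real A * ((1 - of_real q) * y) ^ (2 * n) = of_real (A * (1 - q) ^ (2 * n)) * y ^ (2 * n)"
    for A :: real by (simp add: power_mult_distrib)
  ultimately show "(- 1) ^ n * of_real (q ^ (n * (n + 1))) * y ^ (2 * n) / of_real (q_fact q (2 * n)) =
         of_real (q_binom_coeff 1 0 (q\<^sup>2) n * (q\<^sup>2) ^ n / q_poch q (q\<^sup>2) n) * ((1 - of_real q) * y) ^ (2 * n)"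
    by (simp only:)
qed

lemma q_sin_eq_dk_odd: "q_sin q y = dk_odd q q ((1 - of_real q) * y)"
  unfolding q_sin_def dk_odd_def
proof (intro suminf_cong)
  fix n
  have "q_poch q q (2 * n + 1) = q_poch q (q\<^sup>2) (Suc n) * q_poch (q\<^sup>2) (q\<^sup>2) n"
    by (simp add: q_poch_Suc q_poch_double[OF q] power_mult)
  then have "q_binom_coeff 1 0 (q\<^sup>2) n * (q\<^sup>2) ^ n / q_poch q (q\<^sup>2) (Suc n) * (1 - q) ^ (2 * n + 1)
      = (- 1) ^ n * q ^ (n * (n + 1)) / q_fact q (2 * n + 1)"
    unfolding Euler_coeff_eq[OF q] q_fact_eq by simp
  moreover have "(- 1) ^ n * of_real r * y ^ (2 * n + 1) / of_real F = of_real ((- 1) ^ n * r / F) * y ^ (2 * n + 1)"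
    for r F :: real by simp
  moreover have "of_real A * ((1 - of_real q) * y) ^ (2 * n + 1) = of_real (A * (1 - q) ^ (2 * n + 1)) * y ^ (2 * n + 1)"
    for A :: real by (simp add: power_mult_distrib)
  ultimately show "(- 1) ^ n * of_real (q ^ (n * (n + 1))) * y ^ (2 * n + 1) / of_real (q_fact q (2 * n + 1)) =
         of_real (q_binom_coeff 1 0 (q\<^sup>2) n * (q\<^sup>2) ^ n / q_poch q (q\<^sup>2) (Suc n)) * ((1 - of_real q) * y) ^ (2 * n + 1)"
    by (simp only:)
qed

lemma q_e_eq_dk: "q_e q (\<i> * y) = dk q q ((1 - of_real q) * y)"
  by (simp add: q_e_def dk_def q_cos_eq_dk_even q_sin_eq_dk_odd flip: mult.assoc)

section \<open>Difference equations and the eigenvalue equation\<close>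

lemma dk_odd_difference:
  assumes "0 \<le> a * q" "a * q < 1"
  shows "dk_odd q (a * q) u - of_real a * dk_odd q (a * q) (of_real q * u) = u * dk_even q (a * q) u"
proof -
  note s = summable_dk_odd[OF q assms]
  have "of_real (q_binom_coeff 1 0 (q\<^sup>2) n * (q\<^sup>2) ^ n / q_poch (a * q) (q\<^sup>2) (Suc n)) * u ^ (2 * n + 1)
      - of_real a * (of_real (q_binom_coeff 1 0 (q\<^sup>2) n * (q\<^sup>2) ^ n / q_poch (a * q) (q\<^sup>2) (Suc n)) * (of_real q * u) ^ (2 * n + 1))
      = u * (of_real (q_binom_coeff 1 0 (q\<^sup>2) n * (q\<^sup>2) ^ n / q_poch (a * q) (q\<^sup>2) n) * u ^ (2 * n))" for n
  proof -
    let ?c = "q_binom_coeff 1 0 (q\<^sup>2) n * (q\<^sup>2) ^ n"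
    have "0 < q_poch (a * q) (q\<^sup>2) (Suc n)" using assms by (intro q_poch_pos q_square_bounds q)
    \<comment> \<open>The factor 1 - a q^(2n+1) produced by the dilation is the last factor of the
      denominator.\<close>
    then have "?c / q_poch (a * q) (q\<^sup>2) (Suc n) * (1 - a * q ^ (2 * n + 1)) = ?c / q_poch (a * q) (q\<^sup>2) n"
      by (auto simp: q_poch_Suc power_mult mult.assoc)
    then have "complex_of_real (?c / q_poch (a * q) (q\<^sup>2) n)
        = complex_of_real (?c / q_poch (a * q) (q\<^sup>2) (Suc n)) * (1 - of_real a * of_real q ^ (2 * n + 1))"
      by (metis of_real_1 of_real_diff of_real_mult of_real_power)
    moreover have "A * u ^ (2 * n + 1) - of_real a * (A * (of_real q * u) ^ (2 * n + 1))
        = u * (A * (1 - of_real a * of_real q ^ (2 * n + 1)) * u ^ (2 * n))" for A :: complex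
      by (simp add: algebra_simps power_mult_distrib)
    ultimately show ?thesis by (simp only:)
  qed
  then have "u * dk_even q (a * q) u = (\<Sum>n. of_real (q_binom_coeff 1 0 (q\<^sup>2) n * (q\<^sup>2) ^ n / q_poch (a * q) (q\<^sup>2) (Suc n)) * u ^ (2 * n + 1)
      - of_real a * (of_real (q_binom_coeff 1 0 (q\<^sup>2) n * (q\<^sup>2) ^ n / q_poch (a * q) (q\<^sup>2) (Suc n)) * (of_real q * u) ^ (2 * n + 1)))"
    unfolding dk_even_def by (simp only: suminf_mult[OF summable_dk_even[OF q assms]])
  also have "\<dots> = dk_odd q (a * q) u - of_real a * dk_odd q (a * q) (of_real q * u)"
    unfolding dk_odd_def
    by (subst suminf_diff[symmetric]) (use s in \<open>simp_all only: suminf_mult summable_mult\<close>)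
  finally show ?thesis by simp
qed

text \<open>The constant terms cancel. After an index shift the dilation by 1/q produces 1 -
  q^(2n+2), which cancels the last denominator of Euler's coefficient.\<close>

lemma dk_even_difference:
  assumes "0 \<le> \<beta>" "\<beta> < 1"
  shows "dk_even q \<beta> (inverse (of_real q) * u) - dk_even q \<beta> u = - u * dk_odd q \<beta> u"
proof -
  note s = summable_dk_even[OF q assms]
  let ?f = "\<lambda>n. of_real (q_binom_coeff 1 0 (q\<^sup>2) n * (q\<^sup>2) ^ n / q_poch \<beta> (q\<^sup>2) n) * (inverse (of_real q) * u) ^ (2 * n)
      - of_real (q_binom_coeff 1 0 (q\<^sup>2) n * (q\<^sup>2) ^ n / q_poch \<beta> (q\<^sup>2) n) * u ^ (2 * n)"
  have f: "?f (Suc n) = - u * (of_real (q_binom_coeff 1 0 (q\<^sup>2) n * (q\<^sup>2) ^ n / q_poch \<beta> (q\<^sup>2) (Suc n)) * u ^ (2 * n + 1))" for n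
  proof -
    let ?e = "q_binom_coeff 1 0 (q\<^sup>2)"
    let ?Q = "q_poch \<beta> (q\<^sup>2) (Suc n)"
    have 1: "?e (Suc n) * (1 - (q\<^sup>2) ^ Suc n) = - (?e n * (q\<^sup>2) ^ n)"
      using power_base_bounds(3)[OF q_square_bounds[OF q], of n] by (simp add: q_binom_coeff_Suc)
    have 2: "(q\<^sup>2) ^ Suc n * inverse q ^ (2 * Suc n) = 1"
      unfolding power_mult[of _ 2] power_mult_distrib[symmetric] using q by simp
    have "?e (Suc n) * (q\<^sup>2) ^ Suc n / ?Q * inverse q ^ (2 * Suc n) - ?e (Suc n) * (q\<^sup>2) ^ Suc n / ?Q
        = ?e (Suc n) * ((q\<^sup>2) ^ Suc n * inverse q ^ (2 * Suc n)) / ?Q - ?e (Suc n) * (q\<^sup>2) ^ Suc n / ?Q"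
      by simp
    also have "\<dots> = ?e (Suc n) * (1 - (q\<^sup>2) ^ Suc n) / ?Q"
      unfolding 2 by (simp add: algebra_simps diff_divide_distrib)
    also have "\<dots> = - (?e n * (q\<^sup>2) ^ n / ?Q)"
      unfolding 1 by simp
    finally have 3: "?e (Suc n) * (q\<^sup>2) ^ Suc n / ?Q * inverse q ^ (2 * Suc n) - ?e (Suc n) * (q\<^sup>2) ^ Suc n / ?Q
        = - (?e n * (q\<^sup>2) ^ n / ?Q)" .
    have "?f (Suc n) = of_real (?e (Suc n) * (q\<^sup>2) ^ Suc n / ?Q * inverse q ^ (2 * Suc n) - ?e (Suc n) * (q\<^sup>2) ^ Suc n / ?Q) * u ^ (2 * Suc n)"
      by (simp only: of_real_diff of_real_mult of_real_power of_real_inverse power_mult_distrib left_diff_distrib mult.assoc)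
    then show ?thesis unfolding 3 by simp
  qed
  have fs: "summable ?f" by (intro summable_diff s)
  have "dk_even q \<beta> (inverse (of_real q) * u) - dk_even q \<beta> u = (\<Sum>n. ?f n)"
    unfolding dk_even_def by (intro suminf_diff s)
  also have "\<dots> = (\<Sum>n. ?f (Suc n))"
    using suminf_split_head[OF fs] by simp
  also have "\<dots> = - u * dk_odd q \<beta> u"
    unfolding f dk_odd_def by (intro suminf_mult summable_dk_odd q assms)
  finally show ?thesis .
qed

text \<open>The operator compares the even part at x/q and x, and the odd part at x and qx. The two
  difference equations therefore exchange the parts, up to a factor \<open>c * x\<close>.\<close>

lemma q_Dunkl_op_dk:
  assumes "- (1 / 2) \<le> \<alpha>" "x \<noteq> 0"
  shows "q_Dunkl_op \<alpha> q (\<lambda>x. dk q (q powr (2 * \<alpha> + 2)) (c * x)) x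
       = \<i> * c / (1 - of_real q) * dk q (q powr (2 * \<alpha> + 2)) (c * x)"
proof -
  define \<beta> where "\<beta> = q powr (2 * \<alpha> + 2)"
  define a where "a = q powr (2 * \<alpha> + 1)"
  define E where "E y = dk_even q \<beta> (c * y)" for y
  define S where "S y = dk_odd q \<beta> (c * y)" for y
  have \<beta>: "\<beta> = a * q" unfolding a_def \<beta>_def
    using q powr_add[of q "2 * \<alpha> + 1" 1] by (simp add: algebra_simps)
  note bounds = beta_bounds[OF assms(1), folded \<beta>_def]
  have Em: "E (- y) = E y" and Sm: "S (- y) = - S y" for y
    by (simp_all add: E_def S_def dk_even_minus dk_odd_minus[OF q bounds])
  have ev: "E (inverse (of_real q) * x) = E x - c * x * S x"
    using dk_even_difference[OF bounds, of "c * x"] unfolding E_def S_def by (simp add: algebra_simps)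
  have od: "S x = of_real a * S (of_real q * x) + c * x * E x"
    using dk_odd_difference[of a "c * x"] bounds unfolding E_def S_def \<beta> by (simp add: algebra_simps)
  have f: "dk q \<beta> (c * y) = E y + \<i> * S y" for y by (simp add: dk_def E_def S_def)
  have H: "H_op \<alpha> q (\<lambda>x. dk q \<beta> (c * x)) = (\<lambda>y. E y + of_real a * (\<i> * S y))"
    unfolding H_op_def even_part_def odd_part_def f Em Sm a_def[symmetric]
    by (rule ext) (simp add: add_divide_distrib)
  have d: "q_deriv q (\<lambda>y. E y + of_real a * (\<i> * S y)) x
     = (- (c * x * S x) + \<i> * of_real a * (S x - S (of_real q * x))) / ((1 - of_real q) * x)"
  proof -
    have "E (inverse (of_real q) * x) + of_real a * (\<i> * S (inverse (of_real q) * x))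
        + (E (- (inverse (of_real q) * x)) + of_real a * (\<i> * S (- (inverse (of_real q) * x))))
        - (E (of_real q * x) + of_real a * (\<i> * S (of_real q * x)))
        + (E (- (of_real q * x)) + of_real a * (\<i> * S (- (of_real q * x))))
        - 2 * (E (- x) + of_real a * (\<i> * S (- x)))
      = 2 * (- (c * x * S x) + \<i> * of_real a * (S x - S (of_real q * x)))"
      unfolding Em Sm ev by (simp add: algebra_simps)
    then show ?thesis unfolding q_deriv_def by (simp only: mult.assoc mult_divide_mult_cancel_left[OF zero_neq_numeral[symmetric]])
  qed
  have n: "complex_of_real (q_num q (2 * \<alpha> + 1)) * ((dk q \<beta> (c * x) - dk q \<beta> (c * (- x))) / (2 * x))
      = \<i> * (1 - of_real a) * S x / ((1 - of_real q) * x)"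
    unfolding f Em Sm q_num_def a_def[symmetric] by simp
  have q1: "1 - complex_of_real q \<noteq> 0" using q by (metis of_real_1 of_real_diff of_real_eq_0_iff eq_iff_diff_eq_0 less_irrefl)
  have "q_Dunkl_op \<alpha> q (\<lambda>x. dk q \<beta> (c * x)) x
      = (- (c * x * S x) + \<i> * of_real a * (S x - S (of_real q * x))) / ((1 - of_real q) * x)
        + \<i> * (1 - of_real a) * S x / ((1 - of_real q) * x)"
    unfolding q_Dunkl_op_def H d n ..
  \<comment> \<open>The reflection term supplies \<open>(1 - a) * S x\<close>, turning
    \<open>a * (S x - S (q * x))\<close> into \<open>S x - a * S (q * x)\<close>, the left side of
    the odd difference equation.\<close>
  also have "\<dots> = (- (c * x * S x) + \<i> * (S x - of_real a * S (of_real q * x))) / ((1 - of_real q) * x)"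
    unfolding add_divide_distrib[symmetric] by (simp add: algebra_simps)
  also have "S x - of_real a * S (of_real q * x) = c * x * E x" using od by simp
  also have "(- (c * x * S x) + \<i> * (c * x * E x)) = \<i> * c * (E x + \<i> * S x) * x"
    by (simp add: algebra_simps)
  finally show ?thesis using assms(2) q1 unfolding \<beta>_def[symmetric] f by simp
qed

text \<open>For \<alpha> = -1/2 the operator \<open>H_op\<close> is the identity and the reflection
  term has coefficient [0]_q = 0, so the q-Dunkl operator is \<open>q_deriv\<close>.\<close>

lemma q_deriv_dk:
  assumes "x \<noteq> 0"
  shows "q_deriv q (\<lambda>x. dk q q (c * x)) x = \<i> * c / (1 - of_real q) * dk q q (c * x)"
proof -
  have H: "H_op (- (1 / 2)) q f = f" for f
    using q by (auto simp: H_op_def even_part_def odd_part_def fun_eq_iff simp flip: add_divide_distrib)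
  then have "q_Dunkl_op (- (1 / 2)) q f = q_deriv q f" for f
    unfolding q_Dunkl_op_def H using q by (intro ext) (simp add: q_num_def)
  then show ?thesis using q_Dunkl_op_dk[of "- (1 / 2)" x c] assms q by simp
qed

end

section \<open>Rapid decrease and behaviour at the origin\<close>

lemma sums_moment_swap:
  fixes A :: "nat \<Rightarrow> complex" and \<mu> t M :: "nat \<Rightarrow> real"
  assumes \<mu>: "\<And>k. 0 \<le> \<mu> k" "summable \<mu>"
    and t: "\<And>k. 0 \<le> t k" "\<And>k. t k \<le> 1"
    and A: "summable (\<lambda>n. norm (A n))"
    and M: "\<And>n. (\<lambda>k. \<mu> k * t k ^ e n) sums M n"
  shows "(\<lambda>k. of_real (\<mu> k) * (\<Sum>n. A n * of_real (t k ^ e n))) sums (\<Sum>n. A n * of_real (M n))"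
proof -
  let ?f = "\<lambda>k n. of_real (\<mu> k) * (A n * of_real (t k ^ e n))"
  have le1: "norm (A n * of_real (t k ^ e n)) \<le> norm (A n)" for k n
    using t[of k] by (simp add: norm_mult norm_power mult_left_le power_le_one)
  have le: "norm (?f k n) \<le> \<mu> k * norm (A n)" for k n
    using mult_left_mono[OF le1 \<mu>(1)] \<mu>(1)[of k] by (simp add: norm_mult)
  have inner: "(\<Sum>n. ?f k n) = of_real (\<mu> k) * (\<Sum>n. A n * of_real (t k ^ e n))" for k
  proof (rule suminf_mult)
    show "summable (\<lambda>n. A n * of_real (t k ^ e n))"
      by (rule summable_comparison_test[OF _ A]) (use le1 in blast)
  qed
  have outer: "(\<Sum>k. ?f k n) = A n * of_real (M n)" for n
  proof -
    have "(\<lambda>k. A n * of_real (\<mu> k * t k ^ e n)) sums (A n * of_real (M n))"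
      by (intro sums_mult sums_of_real M)
    then show ?thesis by (simp add: sums_iff mult_ac)
  qed
  note swap = suminf_swap_dominated[OF \<mu>(2) A \<mu>(1) _ le] summable_suminf_dominated[OF \<mu>(2) A \<mu>(1) _ le]
  show ?thesis using swap unfolding inner outer by (simp add: sums_iff)
qed

text \<open>With a = q^(2\<alpha>+1) this is the mass that the even measure
  \<open>Mehler_C * Mehler_W / 2\<close> of the q-integral gives to the two points q^k and -q^k
  together. In this form the q-binomial theorem yields its moments.\<close>

definition Mehler_weight :: "real \<Rightarrow> real \<Rightarrow> nat \<Rightarrow> real" where
  "Mehler_weight q a k =
     q_poch_inf q (q\<^sup>2) / q_poch_inf (a * q) (q\<^sup>2) * (q_binom_coeff a 1 (q\<^sup>2) k * q ^ k)"

text \<open>The average over t = q^k and t = -q^k with density 1 + t; for 0 < q < 1 it is a convex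
  combination of two values of the q-exponential.\<close>

definition q_exp_mix :: "real \<Rightarrow> nat \<Rightarrow> complex \<Rightarrow> complex" where
  "q_exp_mix q k u =
     ((1 + of_real (q ^ k)) * dk q q (of_real (q ^ k) * u)
        + (1 - of_real (q ^ k)) * dk q q (- (of_real (q ^ k) * u))) / 2"

lemma q_deriv_linear:
  "q_deriv q (\<lambda>x. a * f x + b * g x) x = a * q_deriv q f x + b * q_deriv q g x"
  unfolding q_deriv_def times_divide_eq_right add_divide_distrib[symmetric]
  by (rule arg_cong[where f = "\<lambda>y. y / _"]) (simp add: algebra_simps)

lemma q_deriv_cmult: "q_deriv q (\<lambda>x. a * f x) x = a * q_deriv q f x"
  using q_deriv_linear[of q a f 0 f x] by simp

text \<open>A q-derivative reads its function at five points only, so pointwise convergence there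
  suffices for termwise differentiation.\<close>

lemma q_deriv_sums:
  assumes "\<And>y. y \<in> {inverse (of_real q) * x, - (inverse (of_real q) * x), of_real q * x, - (of_real q * x), - x}
             \<Longrightarrow> (\<lambda>k. f k y) sums F y"
  shows "(\<lambda>k. q_deriv q (f k) x) sums q_deriv q F x"
  unfolding q_deriv_def
  by (intro sums_divide sums_diff sums_add sums_mult assms) auto

lemma Rq_closed:
  assumes "x \<in> Rq q" "0 < q"
  shows "inverse (of_real q) * x \<in> Rq q" "of_real q * x \<in> Rq q" "x \<noteq> 0"
proof -
  obtain n where n: "x = of_real (q powi n) \<or> x = - of_real (q powi n)"
    using assms by (auto simp: Rq_def)
  have "inverse (of_real q) * x = of_real (q powi (n - 1)) \<or> inverse (of_real q) * x = - of_real (q powi (n - 1))"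
    using n assms(2) by (auto simp: power_int_diff divide_inverse)
  then show "inverse (of_real q) * x \<in> Rq q" unfolding Rq_def by blast
  have "of_real q * x = of_real (q powi (n + 1)) \<or> of_real q * x = - of_real (q powi (n + 1))"
    using n assms(2) by (auto simp: power_int_add mult.commute)
  then show "of_real q * x \<in> Rq q" unfolding Rq_def by blast
  show "x \<noteq> 0" using n assms(2) by auto
qed

lemma Rq_mult:
  assumes "x \<in> Rq q" "y \<in> Rq q" "0 < q"
  shows "x * y \<in> Rq q"
proof -
  obtain m n where "x = of_real (q powi m) \<or> x = - of_real (q powi m)"
    "y = of_real (q powi n) \<or> y = - of_real (q powi n)"
    using assms by (auto simp: Rq_def)
  then have "x * y = of_real (q powi (m + n)) \<or> x * y = - of_real (q powi (m + n))"
    using assms(3) by (auto simp: power_int_add)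
  then show ?thesis unfolding Rq_def by blast
qed

lemma power_Rq: "of_real (q ^ k) \<in> Rq q"
  unfolding Rq_def by (auto intro!: exI[of _ "int k"])

text \<open>The value at 0 is left out because the quotient in \<open>q_deriv\<close> divides by
  zero there; limits at 0 ignore that value.\<close>

definition entire_off_0 :: "(complex \<Rightarrow> complex) \<Rightarrow> bool" where
  "entire_off_0 f \<longleftrightarrow>
     (\<exists>c. (\<forall>z. summable (\<lambda>n. c n * z ^ n)) \<and> (\<forall>z. z \<noteq> 0 \<longrightarrow> f z = (\<Sum>n. c n * z ^ n)))"

lemma entire_off_0_limit:
  assumes "entire_off_0 f"
  shows "\<exists>L. (f \<longlongrightarrow> L) (at 0 within S)"
proof -
  obtain c where c: "\<And>z. summable (\<lambda>n. c n * z ^ n)" "\<And>z. z \<noteq> 0 \<Longrightarrow> f z = (\<Sum>n. c n * z ^ n)"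
    using assms by (auto simp: entire_off_0_def)
  have "((\<lambda>z. \<Sum>n. c n * z ^ n) \<longlongrightarrow> (\<Sum>n. c n * 0 ^ n)) (at 0)"
    using isCont_powser_converges_everywhere[OF c(1), of 0] by (simp add: isCont_def)
  then have "((\<lambda>z. \<Sum>n. c n * z ^ n) \<longlongrightarrow> (\<Sum>n. c n * 0 ^ n)) (at 0 within S)"
    by (rule tendsto_within_subset) simp
  then have "(f \<longlongrightarrow> (\<Sum>n. c n * 0 ^ n)) (at 0 within S)"
    by (rule Lim_transform_eventually) (auto simp: eventually_at_filter c(2))
  then show ?thesis ..
qed

lemma entire_off_0_q_deriv:
  assumes f: "entire_off_0 f" and q: "q \<noteq> 0"
  shows "entire_off_0 (q_deriv q f)"
proof -
  obtain c where c: "\<And>z. summable (\<lambda>n. c n * z ^ n)" "\<And>z. z \<noteq> 0 \<Longrightarrow> f z = (\<Sum>n. c n * z ^ n)"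
    using f by (auto simp: entire_off_0_def)
  define Q where "Q = complex_of_real q"
  \<comment> \<open>The numerator of \<open>q_deriv\<close> sends the monomial z^n to
    \<open>D n * z ^ n\<close>.\<close>
  define D where "D n = inverse Q ^ n + (- inverse Q) ^ n - Q ^ n + (- Q) ^ n - 2 * (- 1) ^ n" for n :: nat
  define F where "F z = (\<Sum>n. c n * z ^ n)" for z
  have cs: "(\<lambda>n. c n * z ^ n) sums F z" for z unfolding F_def using c(1) by (rule summable_sums)
  have num: "(\<lambda>n. c n * D n * z ^ n) sums
      (F (inverse Q * z) + F (- (inverse Q * z)) - F (Q * z) + F (- (Q * z)) - 2 * F (- z))" for z
  proof -
    have *: "c n * D n * z ^ n = c n * (inverse Q * z) ^ n + c n * (- (inverse Q * z)) ^ n - c n * (Q * z) ^ n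
        + c n * (- (Q * z)) ^ n - 2 * (c n * (- z) ^ n)" for n
    proof -
      have neg: "(- (inverse Q * z)) ^ n = (- inverse Q) ^ n * z ^ n" "(- (Q * z)) ^ n = (- Q) ^ n * z ^ n"
        "(- z) ^ n = (- 1) ^ n * z ^ n"
        using power_mult_distrib[of "- inverse Q" z n] power_mult_distrib[of "- Q" z n] power_mult_distrib[of "- 1" z n]
        by simp_all
      have "w * (a + b - c + d - 2 * e) * v = w * (a * v) + w * (b * v) - w * (c * v) + w * (d * v) - 2 * (w * (e * v))"
        for a b c d e v w :: complex by (simp add: algebra_simps)
      then show ?thesis unfolding D_def neg power_mult_distrib[of "inverse Q"] power_mult_distrib[of Q] .
    qed
    show ?thesis unfolding * by (intro sums_diff sums_add sums_mult cs)
  qed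
  \<comment> \<open>Since 1 + 1 - 1 + 1 - 2 = 0, the numerator has no constant term, and dividing it
    by z leaves a power series.\<close>
  have D0: "D 0 = 0" by (simp add: D_def)
  define d where "d n = c (Suc n) * D (Suc n) / (2 * (1 - Q))" for n
  have shift: "(\<lambda>n. c (Suc n) * D (Suc n) * z ^ Suc n) sums
      (F (inverse Q * z) + F (- (inverse Q * z)) - F (Q * z) + F (- (Q * z)) - 2 * F (- z))" for z
    using num[of z] D0 by (subst sums_Suc_iff) simp
  have d: "(\<lambda>n. d n * z ^ n) sums q_deriv q f z" if "z \<noteq> 0" for z
  proof -
    have "(\<lambda>n. c (Suc n) * D (Suc n) * z ^ Suc n / (2 * (1 - Q) * z)) sums
      ((F (inverse Q * z) + F (- (inverse Q * z)) - F (Q * z) + F (- (Q * z)) - 2 * F (- z)) / (2 * (1 - Q) * z))"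
      by (intro sums_divide shift)
    moreover have "c (Suc n) * D (Suc n) * z ^ Suc n / (2 * (1 - Q) * z) = d n * z ^ n" for n
      using that by (simp add: d_def)
    moreover have "q_deriv q f z = (F (inverse Q * z) + F (- (inverse Q * z)) - F (Q * z) + F (- (Q * z)) - 2 * F (- z)) / (2 * (1 - Q) * z)"
      unfolding q_deriv_def F_def Q_def using that q by (simp add: c(2))
    ultimately show ?thesis by simp
  qed
  have "summable (\<lambda>n. d n * z ^ n)" for z
  proof (cases "z = 0")
    case True
    then show ?thesis by simp
  next
    case False
    then show ?thesis using d by (auto simp: sums_iff)
  qed
  then show ?thesis unfolding entire_off_0_def using d by (intro exI[of _ d]) (auto simp: sums_iff)
qed

section \<open>Rapid decrease on \<open>Rq\<close>\<close>

definition rapidly_decreasing :: "real \<Rightarrow> (complex \<Rightarrow> complex) \<Rightarrow> bool" where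
  "rapidly_decreasing q f \<longleftrightarrow> (\<forall>m. \<exists>B. \<forall>x\<in>Rq q. cmod (x ^ m * f x) \<le> B)"

text \<open>The division by \<open>x\<close> in \<open>q_deriv\<close> costs one power of \<open>x\<close>, so boundedness of the derivative itself has to be
  supplied separately.\<close>

lemma rapidly_decreasing_q_deriv:
  assumes f: "rapidly_decreasing q f" and bdd: "\<And>x. x \<in> Rq q \<Longrightarrow> cmod (q_deriv q f x) \<le> C"
    and q: "0 < q" "q < 1"
  shows "rapidly_decreasing q (q_deriv q f)"
  unfolding rapidly_decreasing_def
proof
  fix m
  show "\<exists>B. \<forall>x\<in>Rq q. cmod (x ^ m * q_deriv q f x) \<le> B"
  proof (cases m)
    case 0
    then show ?thesis using bdd by (intro exI[of _ C]) simp
  next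
    case (Suc m')
    obtain B where "\<forall>x\<in>Rq q. cmod (x ^ m' * f x) \<le> B"
      using f[unfolded rapidly_decreasing_def, rule_format, of m'] ..
    then have B: "cmod (x ^ m' * f x) \<le> B" if "x \<in> Rq q" for x
      using that by (rule bspec)
    show ?thesis unfolding Suc
    proof (intro exI ballI)
      fix x assume x: "x \<in> Rq q"
      let ?Q = "complex_of_real q"
      let ?F = "\<lambda>c y. c ^ m' * (y ^ m' * f y)"
      have x0: "x \<noteq> 0" and Q0: "?Q \<noteq> 0" using Rq_closed(3)[OF x q(1)] q by auto
      have Q1': "1 - ?Q = of_real (1 - q)" by simp
      have Q1: "1 - ?Q \<noteq> 0" unfolding Q1' using q by (simp only: of_real_eq_0_iff)
      note mem = Rq_closed(1,2)[OF x q(1)]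
      \<comment> \<open>One power of x cancels the division by x; the remaining
        \<open>x ^ m'\<close> is written as \<open>c ^ m' * y ^ m'\<close> at each sampling point y
        = x / c, where the decay of \<open>f\<close> applies.\<close>
      have "x ^ Suc m' * q_deriv q f x
          = (?F ?Q (inverse ?Q * x) + ?F (- ?Q) (- (inverse ?Q * x)) - ?F (inverse ?Q) (?Q * x)
              + ?F (- inverse ?Q) (- (?Q * x)) - 2 * ?F (- 1) (- x)) / (2 * (1 - ?Q))"
      proof -
        have c: "?Q ^ m' * (inverse ?Q * x) ^ m' = x ^ m'" "(- ?Q) ^ m' * (- (inverse ?Q * x)) ^ m' = x ^ m'"
          "inverse ?Q ^ m' * (?Q * x) ^ m' = x ^ m'" "(- inverse ?Q) ^ m' * (- (?Q * x)) ^ m' = x ^ m'"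
          "(- 1) ^ m' * (- x) ^ m' = x ^ m'"
          unfolding power_mult_distrib[symmetric] using Q0 by (simp_all flip: mult.assoc)
        show ?thesis
          unfolding mult.assoc[symmetric] c
          unfolding q_deriv_def using x0 Q1 by (simp add: field_simps)
      qed
      also have "cmod \<dots> \<le> (B + B + B / q ^ m' + B / q ^ m' + 2 * B) / (2 * (1 - q))"
      proof -
        have n: "cmod (?F c y) \<le> cmod c ^ m' * B" if "y \<in> Rq q" for c y
          using B[OF that] by (simp add: norm_mult norm_power mult_left_mono)
        have B0: "0 \<le> B" using B[OF x] norm_ge_zero order_trans by blast
        have qm: "q ^ m' * B \<le> B" using q B0 by (simp add: mult_left_le_one_le power_le_one)
        have "cmod (?F ?Q (inverse ?Q * x)) \<le> B" "cmod (?F (- ?Q) (- (inverse ?Q * x))) \<le> B"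
          "cmod (?F (inverse ?Q) (?Q * x)) \<le> B / q ^ m'" "cmod (?F (- inverse ?Q) (- (?Q * x))) \<le> B / q ^ m'"
          "cmod (2 * ?F (- 1) (- x)) \<le> 2 * B"
          using n[OF mem(1), of ?Q] n[OF minus_Rq[OF mem(1)], of "- ?Q"] n[OF mem(2), of "inverse ?Q"]
            n[OF minus_Rq[OF mem(2)], of "- inverse ?Q"] n[OF minus_Rq[OF x], of "- 1"] qm q
          by (auto simp: norm_inverse power_inverse divide_inverse mult.commute norm_mult)
        then have "cmod (?F ?Q (inverse ?Q * x) + ?F (- ?Q) (- (inverse ?Q * x)) - ?F (inverse ?Q) (?Q * x)
              + ?F (- inverse ?Q) (- (?Q * x)) - 2 * ?F (- 1) (- x)) \<le> B + B + B / q ^ m' + B / q ^ m' + 2 * B"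
          by (intro norm_triangle_le norm_triangle_le_diff add_mono)
        moreover have "cmod (2 * (1 - ?Q)) = 2 * (1 - q)"
          unfolding Q1' norm_mult norm_of_real using q by simp
        ultimately show ?thesis using q by (simp add: norm_divide divide_right_mono)
      qed
      finally show "cmod (x ^ Suc m' * q_deriv q f x) \<le> (B + B + B / q ^ m' + B / q ^ m' + 2 * B) / (2 * (1 - q))" .
    qed
  qed
qed

section \<open>The Mehler representation\<close>

text \<open>The even and odd series are interleaved into a single power series in x.\<close>

lemma entire_off_0_dk:
  assumes q: "0 < q" "q < 1" and \<beta>: "0 \<le> \<beta>" "\<beta> < 1"
  shows "entire_off_0 (\<lambda>x. dk q \<beta> (K * x))"
proof -
  define A where "A n = complex_of_real (q_binom_coeff 1 0 (q\<^sup>2) n * (q\<^sup>2) ^ n / q_poch \<beta> (q\<^sup>2) n)" for n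
  define B where "B n = complex_of_real (q_binom_coeff 1 0 (q\<^sup>2) n * (q\<^sup>2) ^ n / q_poch \<beta> (q\<^sup>2) (Suc n))" for n
  define c where "c m = (if even m then A (m div 2) else \<i> * B ((m - 1) div 2)) * K ^ m" for m
  have "(\<lambda>m. c m * x ^ m) sums dk q \<beta> (K * x)" for x
  proof -
    have "(\<lambda>n. A n * (K * x) ^ (2 * n)) sums dk_even q \<beta> (K * x)"
      unfolding dk_even_def A_def by (intro summable_sums summable_dk_even q \<beta>)
    moreover have "A n * (K * x) ^ (2 * n) = (if even (2 * n) then c (2 * n) * x ^ (2 * n) else 0)" for n
      by (simp add: c_def power_mult_distrib)
    ultimately have even_terms: "(\<lambda>n. if even (2 * n) then c (2 * n) * x ^ (2 * n) else 0) sums dk_even q \<beta> (K * x)"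
      by (simp only:)
    have even: "(\<lambda>m. if even m then c m * x ^ m else 0) sums dk_even q \<beta> (K * x)"
    proof (rule iffD1[OF sums_mono_reindex[of "\<lambda>n. 2 * n"]])
      show "strict_mono (\<lambda>n::nat. 2 * n)" by (simp add: strict_mono_def)
      show "(if even m then c m * x ^ m else 0) = 0" if "m \<notin> range (\<lambda>n. 2 * n)" for m
        using that by (auto elim!: evenE)
    qed (rule even_terms)
    have "(\<lambda>n. \<i> * (B n * (K * x) ^ (2 * n + 1))) sums (\<i> * dk_odd q \<beta> (K * x))"
      unfolding dk_odd_def B_def by (intro sums_mult summable_sums summable_dk_odd q \<beta>)
    moreover have "\<i> * (B n * (K * x) ^ (2 * n + 1))
        = (if odd (2 * n + 1) then c (2 * n + 1) * x ^ (2 * n + 1) else 0)" for n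
      by (simp add: c_def power_mult_distrib)
    ultimately have odd_terms: "(\<lambda>n. if odd (2 * n + 1) then c (2 * n + 1) * x ^ (2 * n + 1) else 0) sums (\<i> * dk_odd q \<beta> (K * x))"
      by (simp only:)
    have odd: "(\<lambda>m. if odd m then c m * x ^ m else 0) sums (\<i> * dk_odd q \<beta> (K * x))"
    proof (rule iffD1[OF sums_mono_reindex[of "\<lambda>n. 2 * n + 1"]])
      show "strict_mono (\<lambda>n::nat. 2 * n + 1)" by (simp add: strict_mono_def)
      show "(if odd m then c m * x ^ m else 0) = 0" if "m \<notin> range (\<lambda>n. 2 * n + 1)" for m
        using that by (auto elim!: oddE)
    qed (rule odd_terms)
    have "(if even m then c m * x ^ m else 0) + (if odd m then c m * x ^ m else 0) = c m * x ^ m" for m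
      by simp
    then show ?thesis using sums_add[OF even odd] unfolding dk_def by (simp only:)
  qed
  then show ?thesis unfolding entire_off_0_def by (intro exI[of _ c]) (auto simp only: sums_iff)
qed

context
  fixes q :: real
  assumes q: "0 < q" "q < 1"
begin

section \<open>The Mehler weights and their moments\<close>

context
  fixes a :: real
  assumes a: "0 < a" "a < 1"
begin

lemma aq_bounds: "0 \<le> a * q" "a * q < 1"
  using a q mult_strict_mono[of a 1 q 1] by auto

lemma Mehler_weight_nonneg: "0 \<le> Mehler_weight q a k"
proof -
  have "0 < q_poch_inf q (q\<^sup>2)" "0 < q_poch_inf (a * q) (q\<^sup>2)"
    using q by (auto intro!: q_poch_inf_pos q_square_bounds aq_bounds)
  moreover have "0 < q_poch a (q\<^sup>2) k" "0 < q_poch (q\<^sup>2) (q\<^sup>2) k"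
    using a q_square_bounds[OF q] by (auto intro!: q_poch_pos)
  ultimately show ?thesis
    using q by (simp add: Mehler_weight_def q_binom_coeff_eq[OF q_square_bounds[OF q]])
qed

text \<open>The q-binomial theorem at \<open>z = q * (q\<^sup>2) ^ n\<close> gives a quotient of
  infinite products; against the normalising constant only the first n factors survive.\<close>

lemma Mehler_weight_moment:
  "(\<lambda>k. Mehler_weight q a k * (q ^ k) ^ (2 * n)) sums (q_poch q (q\<^sup>2) n / q_poch (a * q) (q\<^sup>2) n)"
proof -
  note p = q_square_bounds[OF q]
  define z where "z = q * (q\<^sup>2) ^ n"
  have "q * (q\<^sup>2) ^ n \<le> q" using q power_base_bounds(2)[OF p, of n] by (intro mult_left_le) auto
  then have "z \<le> q" by (simp only: z_def)
  moreover have "0 \<le> z" using q by (simp add: z_def)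
  ultimately have z: "0 \<le> z" "z < 1" using q by linarith+
  have "a * z < 1" using z a mult_strict_mono[of a 1 z 1] by auto
  then have pos: "0 < q_poch_inf z (q\<^sup>2)" "0 < q_poch_inf (a * z) (q\<^sup>2)"
    "0 < q_poch (a * q) (q\<^sup>2) n" "0 < q_poch q (q\<^sup>2) n"
    using z a aq_bounds q by (auto intro!: q_poch_inf_pos q_poch_pos p)
  have 1: "\<bar>1 * z\<bar> < 1" using z by simp
  have "(\<lambda>k. q_binom_coeff a 1 (q\<^sup>2) k * z ^ k) sums (q_poch_inf (a * z) (q\<^sup>2) / q_poch_inf z (q\<^sup>2))"
  proof -
    have "(\<Sum>k. q_binom_coeff a 1 (q\<^sup>2) k * z ^ k) = q_poch_inf (a * z) (q\<^sup>2) / q_poch_inf z (q\<^sup>2)"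
      using q_binom_series[OF p 1, of a] pos(1) by (simp add: eq_divide_eq mult.commute)
    then show ?thesis using summable_sums[OF summable_q_binom[OF p 1, of a]] by simp
  qed
  from sums_mult[OF this, of "q_poch_inf q (q\<^sup>2) / q_poch_inf (a * q) (q\<^sup>2)"]
  have "(\<lambda>k. q_poch_inf q (q\<^sup>2) / q_poch_inf (a * q) (q\<^sup>2) * (q_binom_coeff a 1 (q\<^sup>2) k * z ^ k)) sums
      (q_poch_inf q (q\<^sup>2) / q_poch_inf (a * q) (q\<^sup>2) * (q_poch_inf (a * z) (q\<^sup>2) / q_poch_inf z (q\<^sup>2)))" .
  moreover have "q_poch_inf q (q\<^sup>2) / q_poch_inf (a * q) (q\<^sup>2) * (q_poch_inf (a * z) (q\<^sup>2) / q_poch_inf z (q\<^sup>2))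
      = q_poch q (q\<^sup>2) n / q_poch (a * q) (q\<^sup>2) n"
  proof -
    have "q_poch_inf q (q\<^sup>2) = q_poch q (q\<^sup>2) n * q_poch_inf z (q\<^sup>2)"
      "q_poch_inf (a * q) (q\<^sup>2) = q_poch (a * q) (q\<^sup>2) n * q_poch_inf (a * z) (q\<^sup>2)"
      unfolding z_def mult.assoc[symmetric] by (rule q_poch_inf_split[OF p])+
    then show ?thesis using pos by simp
  qed
  moreover have "z ^ k = q ^ k * (q ^ k) ^ (2 * n)" for k
    by (simp add: z_def power_mult_distrib mult_ac flip: power_mult)
  ultimately show ?thesis unfolding Mehler_weight_def by (simp only: mult.assoc)
qed

lemma Mehler_weight_sums_1: "Mehler_weight q a sums 1"
  using Mehler_weight_moment[of 0] by simp

text \<open>Multiplying the coefficients of the q-exponential by the moments replaces the parameter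
  q by a q in the denominators; dominated exchange of sums makes this rigorous.\<close>

lemma dk_Mehler: "(\<lambda>k. of_real (Mehler_weight q a k) * q_exp_mix q k u) sums dk q (a * q) u"
proof -
  define A where "A n = complex_of_real (q_binom_coeff 1 0 (q\<^sup>2) n * (q\<^sup>2) ^ n / q_poch q (q\<^sup>2) n) * u ^ (2 * n + 0)" for n
  define B where "B n = complex_of_real (q_binom_coeff 1 0 (q\<^sup>2) n * (q\<^sup>2) ^ n / q_poch q (q\<^sup>2) (Suc n)) * u ^ (2 * n + 1)" for n
  have q0: "0 \<le> q" using q by simp
  have AB: "summable (\<lambda>n. norm (A n))" "summable (\<lambda>n. norm (B n))"
    unfolding A_def B_def by (intro summable_dk q q0)+
  have t: "0 \<le> q ^ k" "q ^ k \<le> 1" for k using q by (auto simp: power_le_one)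
  note swap = Mehler_weight_nonneg sums_summable[OF Mehler_weight_sums_1] t AB Mehler_weight_moment
  have even: "(\<lambda>k. of_real (Mehler_weight q a k) * dk_even q q (of_real (q ^ k) * u)) sums dk_even q (a * q) u"
  proof -
    have "(\<Sum>n. A n * of_real ((q ^ k) ^ (2 * n))) = dk_even q q (of_real (q ^ k) * u)" for k
      unfolding dk_even_def A_def
      by (intro suminf_cong) (simp only: power_mult_distrib of_real_power add_0_right mult_ac)
    moreover have "(\<Sum>n. A n * of_real (q_poch q (q\<^sup>2) n / q_poch (a * q) (q\<^sup>2) n)) = dk_even q (a * q) u"
      unfolding dk_even_def
    proof (intro suminf_cong)
      fix n
      have "q_poch q (q\<^sup>2) n \<noteq> 0" using q_poch_pos[OF q_square_bounds[OF q] q(2), of n] by simp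
      then show "A n * of_real (q_poch q (q\<^sup>2) n / q_poch (a * q) (q\<^sup>2) n)
        = of_real (q_binom_coeff 1 0 (q\<^sup>2) n * (q\<^sup>2) ^ n / q_poch (a * q) (q\<^sup>2) n) * u ^ (2 * n)"
        unfolding A_def by simp
    qed
    moreover have "(\<lambda>k. of_real (Mehler_weight q a k) * (\<Sum>n. A n * of_real ((q ^ k) ^ (2 * n))))
       sums (\<Sum>n. A n * of_real (q_poch q (q\<^sup>2) n / q_poch (a * q) (q\<^sup>2) n))"
      by (rule sums_moment_swap) (rule swap)+
    ultimately show ?thesis by (simp only:)
  qed
  have odd: "(\<lambda>k. of_real (Mehler_weight q a k) * (of_real (q ^ k) * dk_odd q q (of_real (q ^ k) * u))) sums dk_odd q (a * q) u"
  proof -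
    \<comment> \<open>One factor q^k comes from the mixture and 2n + 1 from the argument, so the
      moment has index \<open>Suc n\<close>, as the denominators of \<open>dk_odd\<close>
      require.\<close>
    have "(\<Sum>n. B n * of_real ((q ^ k) ^ (2 * Suc n))) = of_real (q ^ k) * dk_odd q q (of_real (q ^ k) * u)" for k
      unfolding dk_odd_def suminf_mult[OF summable_dk_odd[OF q q0 q(2)], symmetric] B_def
      by (intro suminf_cong) (simp add: power_mult_distrib mult_ac)
    moreover have "(\<Sum>n. B n * of_real (q_poch q (q\<^sup>2) (Suc n) / q_poch (a * q) (q\<^sup>2) (Suc n))) = dk_odd q (a * q) u"
      unfolding dk_odd_def
    proof (intro suminf_cong)
      fix n
      have "q_poch q (q\<^sup>2) (Suc n) \<noteq> 0" using q_poch_pos[OF q_square_bounds[OF q] q(2), of "Suc n"] by simp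
      then show "B n * of_real (q_poch q (q\<^sup>2) (Suc n) / q_poch (a * q) (q\<^sup>2) (Suc n))
        = of_real (q_binom_coeff 1 0 (q\<^sup>2) n * (q\<^sup>2) ^ n / q_poch (a * q) (q\<^sup>2) (Suc n)) * u ^ (2 * n + 1)"
        unfolding B_def by simp
    qed
    moreover have "(\<lambda>k. of_real (Mehler_weight q a k) * (\<Sum>n. B n * of_real ((q ^ k) ^ (2 * Suc n))))
       sums (\<Sum>n. B n * of_real (q_poch q (q\<^sup>2) (Suc n) / q_poch (a * q) (q\<^sup>2) (Suc n)))"
      by (rule sums_moment_swap) (rule swap)+
    ultimately show ?thesis by (simp only:)
  qed
  \<comment> \<open>In the average with weights (1 + t)/2 and (1 - t)/2 the even parts add up to one
    copy and the odd parts leave a factor t = q^k.\<close>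
  have "q_exp_mix q k u = dk_even q q (of_real (q ^ k) * u) + \<i> * (of_real (q ^ k) * dk_odd q q (of_real (q ^ k) * u))" for k
    unfolding q_exp_mix_def dk_def dk_even_minus dk_odd_minus[OF q q0 q(2)] by (simp add: field_simps)
  then have "of_real (Mehler_weight q a k) * q_exp_mix q k u
     = of_real (Mehler_weight q a k) * dk_even q q (of_real (q ^ k) * u)
       + \<i> * (of_real (Mehler_weight q a k) * (of_real (q ^ k) * dk_odd q q (of_real (q ^ k) * u)))" for k
    by (simp only: distrib_left mult.left_commute)
  then show ?thesis using sums_add[OF even sums_mult[OF odd, of \<i>]] unfolding dk_def by (simp only:)
qed

end

text \<open>At t = q^k the two products in \<open>Mehler_W\<close> are tails from index k on, and
  their quotient gives the finite factorials in the binomial coefficient.\<close>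

lemma Mehler_weight_eq:
  assumes "- (1 / 2) < \<alpha>"
  shows "Mehler_weight q (q powr (2 * \<alpha> + 1)) k = Mehler_C \<alpha> q * (1 - q) * (q ^ k * Mehler_W \<alpha> q (q ^ k))"
proof -
  note p = q_square_bounds[OF q]
  define a where "a = q powr (2 * \<alpha> + 1)"
  have a: "0 < a" "a < 1" using q assms powr_less_mono'[of q 0 "2 * \<alpha> + 1"] by (auto simp: a_def)
  have pos: "0 < q_poch_inf q (q\<^sup>2)" "0 < q_poch_inf (a * q) (q\<^sup>2)" "0 < q_poch_inf a (q\<^sup>2)"
    "0 < q_poch_inf (q\<^sup>2) (q\<^sup>2)" "0 < q_poch a (q\<^sup>2) k" "0 < q_poch (q\<^sup>2) (q\<^sup>2) k"
    using a q p by (auto intro!: q_poch_inf_pos q_poch_pos p aq_bounds)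
  have powrs: "q\<^sup>2 powr (\<alpha> + 1) = a * q" "q\<^sup>2 powr (1 / 2) = q" "q\<^sup>2 powr (\<alpha> + 1 / 2) = a"
    using q powr_add[of q "2 * \<alpha> + 1" 1] unfolding q_square_powr[OF q] a_def by (simp_all add: algebra_simps)
  \<comment> \<open>The powers of 1 - q^2 in the three Gamma values leave (1 - q)(1 + q) in the
    denominator, cancelling 1 + q in the constant and 1 - q from the q-integral.\<close>
  have "(1 - q\<^sup>2) powr (1 / 2) * (1 - q\<^sup>2) powr (1 / 2 - \<alpha>) = (1 - q\<^sup>2) * (1 - q\<^sup>2) powr (- \<alpha>)"
    using p powr_add[of "1 - q\<^sup>2" "1 / 2" "1 / 2 - \<alpha>"] powr_add[of "1 - q\<^sup>2" 1 "- \<alpha>"] by simp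
  moreover have "1 - q\<^sup>2 = (1 - q) * (1 + q)" by (simp add: algebra_simps power2_eq_square)
  ultimately have pw: "(1 - q\<^sup>2) powr (1 / 2) * (1 - q\<^sup>2) powr (1 / 2 - \<alpha>)
     = (1 - q) * (1 + q) * (1 - q\<^sup>2) powr (- \<alpha>)" by simp
  define X where "X = (1 - q\<^sup>2) powr (- \<alpha>)"
  have X: "0 < X" using p by (simp add: X_def)
  have C_unfold: "Mehler_C \<alpha> q = (1 + q) * (q_poch_inf (q\<^sup>2) (q\<^sup>2) / q_poch_inf (a * q) (q\<^sup>2) * X /
     (q_poch_inf (q\<^sup>2) (q\<^sup>2) / q_poch_inf q (q\<^sup>2) * (q_poch_inf (q\<^sup>2) (q\<^sup>2) / q_poch_inf a (q\<^sup>2))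
       * ((1 - q\<^sup>2) powr (1 / 2) * (1 - q\<^sup>2) powr (1 / 2 - \<alpha>))))"
    unfolding Mehler_C_def q_Gamma_def powrs X_def by (simp add: mult_ac)
  have C: "Mehler_C \<alpha> q * (1 - q)
      = q_poch_inf q (q\<^sup>2) * q_poch_inf a (q\<^sup>2) / (q_poch_inf (a * q) (q\<^sup>2) * q_poch_inf (q\<^sup>2) (q\<^sup>2))"
  proof -
    have *: "r * (D / B * X / (D / A * (D / C) * (s * r * X))) * s = A * C / (B * D)"
      if "A \<noteq> 0" "B \<noteq> 0" "C \<noteq> 0" "D \<noteq> 0" "X \<noteq> 0" "r \<noteq> 0" "s \<noteq> 0" for A B C D X r s :: real
      using that by (simp add: field_simps)
    show ?thesis unfolding C_unfold pw X_def[symmetric] by (rule *) (use q pos X in simp_all)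
  qed
  have W: "Mehler_W \<alpha> q (q ^ k) = (q_poch_inf (q\<^sup>2) (q\<^sup>2) / q_poch (q\<^sup>2) (q\<^sup>2) k) / (q_poch_inf a (q\<^sup>2) / q_poch a (q\<^sup>2) k)"
  proof -
    have "(q ^ k)\<^sup>2 = (q\<^sup>2) ^ k" by (simp only: mult.commute flip: power_mult)
    then show ?thesis
      unfolding Mehler_W_def a_def[symmetric]
      using pos q_poch_inf_split[OF p, of "q\<^sup>2" k] q_poch_inf_split[OF p, of a k] by (simp add: mult.commute)
  qed
  show ?thesis
    unfolding C W a_def[symmetric] Mehler_weight_def q_binom_coeff_eq[OF p]
    using pos by (simp add: field_simps)
qed

lemma q_Dunkl_kernel_Mehler:
  assumes "- (1 / 2) < \<alpha>"
  shows "q_Dunkl_kernel \<alpha> q l x = 1 / 2 * of_real (Mehler_C \<alpha> q) *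
           q_integral q (\<lambda>t. of_real (Mehler_W \<alpha> q t * (1 + t)) * q_e q (\<i> * l * x * of_real t))"
proof -
  define a where "a = q powr (2 * \<alpha> + 1)"
  define u where "u = (1 - of_real q) * (l * x)"
  have a: "0 < a" "a < 1" using q assms powr_less_mono'[of q 0 "2 * \<alpha> + 1"] by (auto simp: a_def)
  have aq: "q powr (2 * \<alpha> + 2) = a * q"
    using q powr_add[of q "2 * \<alpha> + 1" 1] by (simp add: a_def algebra_simps)
  have e: "q_e q (\<i> * l * x * of_real t) = dk q q (of_real t * u)" for t
    using q_e_eq_dk[OF q, of "l * x * of_real t"] by (simp add: u_def mult_ac)
  let ?h = "\<lambda>t. of_real (Mehler_W \<alpha> q t * (1 + t)) * q_e q (\<i> * l * x * of_real t)"
  have W: "Mehler_W \<alpha> q (- t) = Mehler_W \<alpha> q t" for t by (simp add: Mehler_W_def)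
  define s where "s k = of_real (q ^ k) * (?h (q ^ k) + ?h (- (q ^ k)))" for k
  have h: "s k = of_real (2 * (q ^ k * Mehler_W \<alpha> q (q ^ k))) * q_exp_mix q k u" for k
    unfolding s_def e W q_exp_mix_def by (simp add: algebra_simps)
  define c where "c = complex_of_real (Mehler_C \<alpha> q * (1 - q)) / 2"
  have summand: "of_real (Mehler_weight q a k) * q_exp_mix q k u = c * s k" for k
    unfolding a_def Mehler_weight_eq[OF assms] h c_def by simp
  have "(\<lambda>k. c * s k) sums dk q (a * q) u"
    using dk_Mehler[OF a, of u] unfolding summand .
  \<comment> \<open>With \<open>c = 0\<close> all weights would vanish although their sum is 1; a
    nonzero \<open>c\<close> can be cancelled to obtain summability of \<open>s\<close>.\<close>
  moreover have "c \<noteq> 0"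
  proof
    assume "c = 0"
    then have "Mehler_C \<alpha> q * (1 - q) = 0" unfolding c_def by (metis divide_eq_0_iff of_real_eq_0_iff zero_neq_numeral)
    then have "Mehler_weight q a = (\<lambda>_. 0)" unfolding a_def by (intro ext) (simp add: Mehler_weight_eq[OF assms])
    then show False using Mehler_weight_sums_1[OF a] by (simp add: sums_iff)
  qed
  ultimately have "summable s" "c * (\<Sum>k. s k) = dk q (a * q) u"
    using suminf_mult[of s c] by (auto simp: summable_cmult_iff sums_iff)
  moreover have "1 / 2 * of_real (Mehler_C \<alpha> q) * q_integral q ?h = c * (\<Sum>k. s k)"
    unfolding q_integral_def s_def c_def by simp
  ultimately show ?thesis
    using assms q_Dunkl_kernel_eq_dk[OF q, of \<alpha> l x] unfolding aq u_def by simp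
qed

text \<open>For \<open>\<alpha> = -1/2\<close> the point mass at \<open>t = 1\<close> takes the role of the Mehler weights.\<close>

lemma dk_mixture:
  assumes "- (1 / 2) \<le> \<alpha>"
  obtains \<mu> where "\<And>k. 0 \<le> \<mu> k" "\<mu> sums 1"
    "\<And>u. (\<lambda>k. of_real (\<mu> k) * q_exp_mix q k u) sums dk q (q powr (2 * \<alpha> + 2)) u"
proof (cases "\<alpha> = - (1 / 2)")
  case True
  define \<mu> :: "nat \<Rightarrow> real" where "\<mu> k = (if k = 0 then 1 else 0)" for k
  have "\<mu> sums 1" using sums_single[of 0 "\<lambda>_. 1 :: real"] by (simp add: \<mu>_def[abs_def])
  moreover have "(\<lambda>k. of_real (\<mu> k) * q_exp_mix q k u) sums dk q (q powr (2 * \<alpha> + 2)) u" for u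
  proof -
    \<comment> \<open>For k = 0 the point is t = 1 and the reflected value has weight (1 - 1)/2 =
      0.\<close>
    have "of_real (\<mu> k) * q_exp_mix q k u = (if k = 0 then dk q q u else 0)" for k
      by (simp add: \<mu>_def q_exp_mix_def)
    then show ?thesis using sums_single[of 0 "\<lambda>_. dk q q u"] True q by simp
  qed
  ultimately show ?thesis using that[of \<mu>] by (simp add: \<mu>_def)
next
  case False
  define a where "a = q powr (2 * \<alpha> + 1)"
  have a: "0 < a" "a < 1" using q assms False powr_less_mono'[of q 0 "2 * \<alpha> + 1"] by (auto simp: a_def)
  have "q powr (2 * \<alpha> + 2) = a * q"
    using q powr_add[of q "2 * \<alpha> + 1" 1] by (simp add: a_def algebra_simps)
  then show ?thesis
    using that[of "Mehler_weight q a"] Mehler_weight_nonneg[OF a] Mehler_weight_sums_1[OF a] dk_Mehler[OF a] by simp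
qed

end

section \<open>Iterated \<open>q\<close>-derivatives\<close>

text \<open>A closed form for the n-th q-derivative, away from 0, of \<open>q_exp_mix q k\<close>
  composed with multiplication by (1 - q) l.\<close>

definition q_exp_mix_deriv :: "real \<Rightarrow> complex \<Rightarrow> nat \<Rightarrow> nat \<Rightarrow> complex \<Rightarrow> complex" where
  "q_exp_mix_deriv q l n k x =
     (\<i> * l * of_real (q ^ k)) ^ n * (1 + of_real (q ^ k)) / 2 * dk q q (of_real (q ^ k) * ((1 - of_real q) * l) * x)
     + (- (\<i> * l * of_real (q ^ k))) ^ n * (1 - of_real (q ^ k)) / 2 * dk q q (- (of_real (q ^ k) * ((1 - of_real q) * l)) * x)"

text \<open>Exponentiating the logarithm condition puts 1 - q into \<open>Rq\<close>, so that the
  normalised argument (1 - q) l x stays in \<open>Rq\<close> with l and x.\<close>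

lemma one_minus_q_powi:
  assumes "0 < q" "q < 1" and "ln (1 - q) / ln q = 2 * real_of_int m"
  shows "1 - q = q powi (2 * m)"
proof -
  have "ln q \<noteq> 0" using assms by simp
  then have "ln (1 - q) = ln q * real_of_int (2 * m)" using assms(3) by (simp add: field_simps)
  then have "1 - q = q powr real_of_int (2 * m)"
    using assms by (simp add: powr_def mult.commute) (metis diff_gt_0_iff_gt exp_ln)
  also have "\<dots> = q powi (2 * m)" using assms by (intro powr_real_of_int') auto
  finally show ?thesis .
qed

context
  fixes q :: real
  assumes q: "0 < q" "q < 1"
begin

text \<open>Both summands are q-exponentials in x, hence eigenfunctions of \<open>q_deriv\<close>;
  their eigenvalues are i l q^k and its negative.\<close>

lemma q_deriv_q_exp_mix_deriv:
  assumes "x \<noteq> 0"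
  shows "q_deriv q (q_exp_mix_deriv q l n k) x = q_exp_mix_deriv q l (Suc n) k x"
proof -
  have q1: "1 - complex_of_real q \<noteq> 0"
    using q by (metis of_real_1 of_real_diff of_real_eq_0_iff eq_iff_diff_eq_0 less_irrefl)
  have "\<i> * (of_real (q ^ k) * ((1 - of_real q) * l)) / (1 - of_real q) = \<i> * l * of_real (q ^ k)"
    using q1 by simp
  then show ?thesis
    unfolding q_exp_mix_deriv_def[abs_def] q_deriv_linear q_deriv_dk[OF q assms]
    by (simp add: mult_ac)
qed

context
  assumes q_int: "\<exists>m. 1 - q = q powi m"
begin

lemma one_minus_q_Rq: "1 - of_real q \<in> Rq q"
proof -
  obtain m where "1 - q = q powi m" using q_int ..
  then have "1 - complex_of_real q = of_real (q powi m)" by (metis of_real_1 of_real_diff)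
  then show ?thesis unfolding Rq_def by blast
qed

text \<open>The weights (1 + q^k)/2 and (1 - q^k)/2 are convex, both arguments lie in
  \<open>Rq\<close>, and each eigenvalue has modulus at most |l|.\<close>

lemma q_exp_mix_deriv_bound:
  assumes "l \<in> Rq q" "x \<in> Rq q"
  shows "cmod (q_exp_mix_deriv q l n k x) \<le> cmod l ^ n * (3 / q_poch_inf q q)"
proof -
  define Q where "Q = q ^ k"
  define B where "B = 3 / q_poch_inf q q"
  have Q: "0 \<le> Q" "Q \<le> 1" using q by (auto simp: Q_def power_le_one)
  have B: "0 \<le> B" using q_poch_inf_pos[OF q, of q] q by (simp add: B_def)
  have mem: "of_real Q * ((1 - of_real q) * l) * x \<in> Rq q"
    unfolding Q_def by (intro Rq_mult power_Rq one_minus_q_Rq assms q)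
  have b1: "cmod (dk q q (of_real Q * ((1 - of_real q) * l) * x)) \<le> B"
    unfolding B_def by (rule q_exp_Rq_bound[OF q mem])
  have b2: "cmod (dk q q (- (of_real Q * ((1 - of_real q) * l)) * x)) \<le> B"
    unfolding B_def mult_minus_left by (rule q_exp_Rq_bound[OF q minus_Rq[OF mem]])
  have w: "(cmod l * Q) ^ n \<le> cmod l ^ n" using Q by (intro power_mono) (auto simp: mult_left_le)
  have "1 + complex_of_real Q = of_real (1 + Q)" "1 - complex_of_real Q = of_real (1 - Q)" by simp_all
  then have n1: "cmod (1 + of_real Q) = 1 + Q" "cmod (1 - of_real Q) = 1 - Q"
    using Q by (simp_all only: norm_of_real abs_of_nonneg add_nonneg_nonneg zero_le_one diff_ge_0_iff_ge)
  have "cmod (q_exp_mix_deriv q l n k x) \<le>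
     cmod ((\<i> * l * of_real Q) ^ n * (1 + of_real Q) / 2 * dk q q (of_real Q * ((1 - of_real q) * l) * x)) +
     cmod ((- (\<i> * l * of_real Q)) ^ n * (1 - of_real Q) / 2 * dk q q (- (of_real Q * ((1 - of_real q) * l)) * x))"
    unfolding q_exp_mix_deriv_def Q_def by (rule norm_triangle_ineq)
  also have "\<dots> = (cmod l * Q) ^ n * (1 + Q) / 2 * cmod (dk q q (of_real Q * ((1 - of_real q) * l) * x)) +
     (cmod l * Q) ^ n * (1 - Q) / 2 * cmod (dk q q (- (of_real Q * ((1 - of_real q) * l)) * x))"
    using Q unfolding norm_mult norm_divide norm_power norm_minus_cancel n1 by simp
  also have "\<dots> \<le> (cmod l * Q) ^ n * (1 + Q) / 2 * B + (cmod l * Q) ^ n * (1 - Q) / 2 * B"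
    using Q by (intro add_mono mult_left_mono b1 b2) auto
  also have "\<dots> = (cmod l * Q) ^ n * B" by (simp add: field_simps)
  also have "\<dots> \<le> cmod l ^ n * B" using w B by (rule mult_right_mono)
  finally show ?thesis unfolding B_def .
qed

text \<open>Termwise q-differentiation keeps the nonnegative weights of total mass 1, so the bound
  for single terms passes to the kernel.\<close>

lemma q_deriv_funpow_kernel_bound:
  assumes \<alpha>: "- (1 / 2) \<le> \<alpha>" and l: "l \<in> Rq q" and x: "x \<in> Rq q"
  shows "cmod ((q_deriv q ^^ n) (q_Dunkl_kernel \<alpha> q l) x) \<le> cmod l ^ n * (3 / q_poch_inf q q)"
proof -
  obtain \<mu> where \<mu>: "\<And>k. 0 \<le> \<mu> k" "\<mu> sums 1"
    "\<And>u. (\<lambda>k. of_real (\<mu> k) * q_exp_mix q k u) sums dk q (q powr (2 * \<alpha> + 2)) u"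
    using dk_mixture[OF q \<alpha>] by metis
  \<comment> \<open>The point varies in the induction, since one more derivative reads the previous
    one at other points of \<open>Rq\<close>.\<close>
  have sums: "(\<lambda>k. of_real (\<mu> k) * q_exp_mix_deriv q l n k x) sums (q_deriv q ^^ n) (q_Dunkl_kernel \<alpha> q l) x"
    if "x \<in> Rq q" for n x
    using that
  proof (induction n arbitrary: x)
    case 0
    have "q_exp_mix_deriv q l 0 k x = q_exp_mix q k ((1 - of_real q) * (l * x))" for k
      by (simp add: q_exp_mix_deriv_def q_exp_mix_def add_divide_distrib mult.assoc)
    then show ?case using \<mu>(3) by (simp add: q_Dunkl_kernel_eq_dk[OF q \<alpha>])
  next
    case (Suc n)
    note mem = Rq_closed[OF Suc.prems q(1)]
    have "(\<lambda>k. q_deriv q (\<lambda>x. of_real (\<mu> k) * q_exp_mix_deriv q l n k x) x) sums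
       q_deriv q ((q_deriv q ^^ n) (q_Dunkl_kernel \<alpha> q l)) x"
      by (rule q_deriv_sums, rule Suc.IH) (use mem Suc.prems in \<open>auto intro: minus_Rq\<close>)
    then show ?case unfolding q_deriv_cmult q_deriv_q_exp_mix_deriv[OF mem(3)] by simp
  qed
  have le: "cmod (of_real (\<mu> k) * q_exp_mix_deriv q l n k x) \<le> \<mu> k * (cmod l ^ n * (3 / q_poch_inf q q))" for k
    using mult_left_mono[OF q_exp_mix_deriv_bound[OF l x] \<mu>(1)] \<mu>(1)[of k] by (simp add: norm_mult)
  have bound: "(\<lambda>k. \<mu> k * (cmod l ^ n * (3 / q_poch_inf q q))) sums (1 * (cmod l ^ n * (3 / q_poch_inf q q)))"
    by (intro sums_mult2 \<mu>(2))
  have "cmod (\<Sum>k. of_real (\<mu> k) * q_exp_mix_deriv q l n k x) \<le> (\<Sum>k. \<mu> k * (cmod l ^ n * (3 / q_poch_inf q q)))"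
    using sums_summable[OF bound] le by (intro norm_suminf_le)
  then show ?thesis using sums_unique[OF sums[OF x, of n]] sums_unique[OF bound] by simp
qed

text \<open>Decay in u = (1 - q) l x is decay in x, at the cost of the constant |(1 - q)
  l|^m.\<close>

lemma q_Dunkl_kernel_rapidly_decreasing:
  assumes \<alpha>: "- (1 / 2) \<le> \<alpha>" and l: "l \<in> Rq q"
  shows "rapidly_decreasing q (q_Dunkl_kernel \<alpha> q l)"
  unfolding rapidly_decreasing_def
proof
  fix m
  let ?c = "(1 - of_real q) * l"
  obtain B where B: "\<And>u. u \<in> Rq q \<Longrightarrow> cmod u ^ m * cmod (dk q (q powr (2 * \<alpha> + 2)) u) \<le> B"
    using dk_Rq_decay[OF q beta_bounds[OF q \<alpha>]] by blast
  have c: "?c \<in> Rq q" by (intro Rq_mult one_minus_q_Rq l q)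
  then have c0: "0 < cmod ?c ^ m" using Rq_closed(3)[OF c q(1)] by (simp only: zero_less_power zero_less_norm_iff not_False_eq_True)
  show "\<exists>B. \<forall>x\<in>Rq q. cmod (x ^ m * q_Dunkl_kernel \<alpha> q l x) \<le> B"
  proof (intro exI ballI)
    fix x assume "x \<in> Rq q"
    then have "cmod (?c * x) ^ m * cmod (dk q (q powr (2 * \<alpha> + 2)) (?c * x)) \<le> B"
      by (intro B Rq_mult c q)
    moreover have "q_Dunkl_kernel \<alpha> q l x = dk q (q powr (2 * \<alpha> + 2)) (?c * x)"
      unfolding q_Dunkl_kernel_eq_dk[OF q \<alpha>] mult.assoc ..
    ultimately have "cmod ?c ^ m * cmod (x ^ m * q_Dunkl_kernel \<alpha> q l x) \<le> B"
      unfolding norm_mult norm_power power_mult_distrib by (simp only: mult.assoc)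
    then show "cmod (x ^ m * q_Dunkl_kernel \<alpha> q l x) \<le> B / cmod ?c ^ m"
      using c0 by (simp only: pos_le_divide_eq mult.commute)
  qed
qed

lemma q_Dunkl_kernel_in_Sq:
  assumes \<alpha>: "- (1 / 2) \<le> \<alpha>" and l: "l \<in> Rq q"
  shows "q_Dunkl_kernel \<alpha> q l \<in> Sq q"
proof -
  let ?f = "q_Dunkl_kernel \<alpha> q l"
  \<comment> \<open>Each induction step is fed the uniform bound for the derivative of the next
    order.\<close>
  have decr: "rapidly_decreasing q ((q_deriv q ^^ n) ?f)" for n
  proof (induction n)
    case 0
    then show ?case using q_Dunkl_kernel_rapidly_decreasing[OF \<alpha> l] by simp
  next
    case (Suc n)
    have "cmod (q_deriv q ((q_deriv q ^^ n) ?f) x) \<le> cmod l ^ Suc n * (3 / q_poch_inf q q)" if "x \<in> Rq q" for x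
      using q_deriv_funpow_kernel_bound[OF \<alpha> l that, of "Suc n"] by simp
    from rapidly_decreasing_q_deriv[OF Suc this q] show ?case by simp
  qed
  have "?f = (\<lambda>x. dk q (q powr (2 * \<alpha> + 2)) ((1 - of_real q) * l * x))"
    by (intro ext) (simp only: q_Dunkl_kernel_eq_dk[OF q \<alpha>] mult.assoc)
  then have "entire_off_0 ?f"
    using entire_off_0_dk[OF q beta_bounds[OF q \<alpha>], of "(1 - of_real q) * l"] by simp
  then have "entire_off_0 ((q_deriv q ^^ n) ?f)" for n
    by (induction n) (use q in \<open>auto intro: entire_off_0_q_deriv\<close>)
  then have "\<exists>L. ((q_deriv q ^^ n) ?f \<longlongrightarrow> L) (at 0 within Rq q)" for n
    by (rule entire_off_0_limit)
  moreover have "bdd_above ((\<lambda>x. cmod (x ^ m * (q_deriv q ^^ n) ?f x)) ` Rq q)" for n m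
  proof -
    obtain B where "\<forall>x\<in>Rq q. cmod (x ^ m * (q_deriv q ^^ n) ?f x) \<le> B"
      using decr[of n, unfolded rapidly_decreasing_def, rule_format, of m] ..
    then show ?thesis by (intro bdd_aboveI2) (rule bspec)
  qed
  ultimately show ?thesis unfolding Sq_def by (intro CollectI conjI allI)
qed

end

text \<open>At real arguments the even and odd parts are real, so conjugation only changes the sign
  of i; by parity this equals a change of sign of the argument.\<close>

lemma cnj_q_Dunkl_kernel:
  assumes \<alpha>: "- (1 / 2) \<le> \<alpha>" and l: "l \<in> \<real>" and x: "x \<in> \<real>"
  shows "cnj (q_Dunkl_kernel \<alpha> q l x) = q_Dunkl_kernel \<alpha> q (- l) x"
proof -
  note b = beta_bounds[OF q \<alpha>]
  obtain r where r: "(1 - of_real q) * (l * x) = complex_of_real r"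
    using l x by (metis Reals_cases Reals_mult of_real_1 of_real_diff Reals_of_real)
  have neg: "(1 - of_real q) * (- l * x) = - complex_of_real r" by (simp flip: r)
  show ?thesis
    unfolding q_Dunkl_kernel_eq_dk[OF q \<alpha>] r neg dk_def dk_even_minus dk_odd_minus[OF q b]
    by (simp add: dk_even_of_real[OF q b] dk_odd_of_real[OF q b])
qed

end

theorem proposition6:
  fixes q \<alpha> :: real
  assumes q: "0 < q" "q < 1"
    and log_q: "\<exists>m::int. ln (1 - q) / ln q = 2 * real_of_int m"
    and alpha: "\<alpha> \<ge> - (1 / 2)"
  shows
    "(\<forall>l x. x \<noteq> 0 \<longrightarrow>
        q_Dunkl_op \<alpha> q (q_Dunkl_kernel \<alpha> q l) x = \<i> * l * q_Dunkl_kernel \<alpha> q l x) \<and>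
     (\<forall>l\<in>\<real>. \<forall>x\<in>\<real>. \<forall>a.
        q_Dunkl_kernel \<alpha> q l x = q_Dunkl_kernel \<alpha> q x l \<and>
        q_Dunkl_kernel \<alpha> q (a * l) x = q_Dunkl_kernel \<alpha> q l (a * x) \<and>
        cnj (q_Dunkl_kernel \<alpha> q l x) = q_Dunkl_kernel \<alpha> q (- l) x) \<and>
     (\<alpha> = - (1 / 2) \<longrightarrow>
        (\<forall>l x. q_Dunkl_kernel \<alpha> q l x = q_e q (\<i> * l * x))) \<and>
     (\<alpha> > - (1 / 2) \<longrightarrow>
        (\<forall>l x. q_Dunkl_kernel \<alpha> q l x =
           1 / 2 * of_real (Mehler_C \<alpha> q) *
           q_integral q (\<lambda>t. of_real (Mehler_W \<alpha> q t * (1 + t)) * q_e q (\<i> * l * x * of_real t)))) \<and>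
     (\<forall>n::nat. \<forall>l\<in>Rq q. \<forall>x\<in>Rq q.
        cmod ((q_deriv q ^^ n) (q_Dunkl_kernel \<alpha> q l) x) \<le> 4 * cmod l ^ n / q_poch_inf q q) \<and>
     (\<forall>l\<in>Rq q.
        bounded (q_Dunkl_kernel \<alpha> q l ` Rq q) \<and>
        (\<forall>x\<in>Rq q. cmod (q_Dunkl_kernel \<alpha> q l x) \<le> 4 / q_poch_inf q q)) \<and>
     (\<forall>l\<in>Rq q. q_Dunkl_kernel \<alpha> q l \<in> Sq q)"
proof (intro conjI)
  have q_int: "\<exists>m. 1 - q = q powi m" using log_q one_minus_q_powi[OF q] by blast
  show "\<forall>l x. x \<noteq> 0 \<longrightarrow> q_Dunkl_op \<alpha> q (q_Dunkl_kernel \<alpha> q l) x = \<i> * l * q_Dunkl_kernel \<alpha> q l x"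
  proof (intro allI impI)
    fix l x :: complex assume x: "x \<noteq> 0"
    have "1 - complex_of_real q \<noteq> 0"
      using q by (metis of_real_1 of_real_diff of_real_eq_0_iff eq_iff_diff_eq_0 less_irrefl)
    then have "\<i> * ((1 - of_real q) * l) / (1 - of_real q) = \<i> * l" by simp
    then show "q_Dunkl_op \<alpha> q (q_Dunkl_kernel \<alpha> q l) x = \<i> * l * q_Dunkl_kernel \<alpha> q l x"
      using q_Dunkl_op_dk[OF q alpha x, of "(1 - of_real q) * l"]
      unfolding q_Dunkl_kernel_eq_dk[OF q alpha, abs_def] mult.assoc by simp
  qed
  \<comment> \<open>The kernel depends on \<open>l\<close> and \<open>x\<close> only through their
    product, which settles the first two identities.\<close>
  show "\<forall>l\<in>\<real>. \<forall>x\<in>\<real>. \<forall>a.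
        q_Dunkl_kernel \<alpha> q l x = q_Dunkl_kernel \<alpha> q x l \<and>
        q_Dunkl_kernel \<alpha> q (a * l) x = q_Dunkl_kernel \<alpha> q l (a * x) \<and>
        cnj (q_Dunkl_kernel \<alpha> q l x) = q_Dunkl_kernel \<alpha> q (- l) x"
    using cnj_q_Dunkl_kernel[OF q alpha] by (simp add: q_Dunkl_kernel_eq_dk[OF q alpha] mult_ac)
  show "\<alpha> = - (1 / 2) \<longrightarrow> (\<forall>l x. q_Dunkl_kernel \<alpha> q l x = q_e q (\<i> * l * x))"
    using q by (auto simp: q_Dunkl_kernel_eq_dk[OF q] q_e_eq_dk[OF q] mult.assoc)
  show "\<alpha> > - (1 / 2) \<longrightarrow> (\<forall>l x. q_Dunkl_kernel \<alpha> q l x =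
           1 / 2 * of_real (Mehler_C \<alpha> q) *
           q_integral q (\<lambda>t. of_real (Mehler_W \<alpha> q t * (1 + t)) * q_e q (\<i> * l * x * of_real t)))"
    using q_Dunkl_kernel_Mehler[OF q] by blast
  have bound: "cmod ((q_deriv q ^^ n) (q_Dunkl_kernel \<alpha> q l) x) \<le> 4 * cmod l ^ n / q_poch_inf q q"
    if "l \<in> Rq q" "x \<in> Rq q" for n l x
  proof -
    \<comment> \<open>The constant 3 = 2 + 1 from the even and odd parts is relaxed to 4.\<close>
    have "cmod l ^ n * (3 / q_poch_inf q q) \<le> 4 * cmod l ^ n / q_poch_inf q q"
      using q_poch_inf_pos[OF q, of q] q by (simp add: divide_right_mono)
    then show ?thesis using q_deriv_funpow_kernel_bound[OF q q_int alpha that, of n] by linarith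
  qed
  then show "\<forall>n::nat. \<forall>l\<in>Rq q. \<forall>x\<in>Rq q.
        cmod ((q_deriv q ^^ n) (q_Dunkl_kernel \<alpha> q l) x) \<le> 4 * cmod l ^ n / q_poch_inf q q"
    by blast
  have bound0: "cmod (q_Dunkl_kernel \<alpha> q l x) \<le> 4 / q_poch_inf q q" if "l \<in> Rq q" "x \<in> Rq q" for l x
    using bound[OF that, of 0] by simp
  then show "\<forall>l\<in>Rq q. bounded (q_Dunkl_kernel \<alpha> q l ` Rq q) \<and>
        (\<forall>x\<in>Rq q. cmod (q_Dunkl_kernel \<alpha> q l x) \<le> 4 / q_poch_inf q q)"
    unfolding bounded_iff by blast
  show "\<forall>l\<in>Rq q. q_Dunkl_kernel \<alpha> q l \<in> Sq q"
    using q_Dunkl_kernel_in_Sq[OF q q_int alpha] by blast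
qed

end
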